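(* Let $G$ be a finite, connected, simple graph with vertices $v_1,\dots,v_m$ and edges $e_1,\dots,e_n$ ($n\ge 1$), let $T_G$ be a spanning tree of $G$, and let $G^{(0)}$ be the symmetric tube of $G$. For each vertex $v_s$ of degree $d=\deg v_s$ let $v_{s_1},\dots,v_{s_d}$ be the vertices adjacent to $v_s$, numbered so that the edges $e_{i_l}=(v_s,v_{s_l})$ satisfy $i_1<i_2<\cdots<i_d$. Then: (1) $$H^{1}(G^{(0)};\mathbb{Z})\cong\bigoplus_{\substack{e_j\in E(G)\setminus E(T_G)\\ e_j=(v_{j_1},v_{j_2})}}\left\langle X_j^{j_1j_2}\right\rangle\oplus\bigoplus_{\substack{v_s\in V(G)\\ \deg v_s\ge 3}}\left(\bigoplus_{1\le j<k\le d-1}\left\langle Y_s^{s_j i_k}\right\rangle\right),$$ where each $\langle\cdot\rangle$ is the infinite cyclic group generated by the cohomology class of the indicated dual cochain, and in the second sum $d=\deg v_s$ and the $s_j,i_k$ are those associated with $v_s$. (2) $$\operatorname{rank}H^{1}(G^{(0)};\mathbb{Z})=1-2n+\frac12\sum_{s=1}^{m}(\deg v_s)^2.$$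
   Context: $e=(u,v)=(v,u)$ denotes an edge with end vertices $u,v$; $G$ is regarded as a $1$-dimensional simplicial complex whose simplices are its vertices and (closed) edges, each edge being given a fixed orientation. Symmetric tube. The tube $\widetilde{G}^{(0)}$ is the cell complex whose cells are $[s,s_1\times s_2]^{(0)}$, for simplices $s,s_1,s_2$ of $G$ with $s_1\cap s_2=\emptyset$ and with $s\cup s_i$ contained in a vertex or an edge of $G$ for $i=1,2$. The cell $[s,s_1\times s_2]^{(0)}$ is the middle slice (join parameter $1/2$) of the join of the diagonal copy of $s$ with $s_1\times s_2$ in $G\times G$, so it is homeomorphic to $s\times s_1\times s_2$; its faces are the cells $[s',s_1'\times s_2']^{(0)}$ with $s'\subset s$, $s_i'\subset s_i$ faces. The group $\mathbb{Z}_2$ acts freely by exchanging the factors, $[s,s_1\times s_2]^{(0)}\mapsto[s,s_2\times s_1]^{(0)}$. The symmetric tube is $G^{(0)}=\widetilde{G}^{(0)}/\mathbb{Z}_2$, and $[s,s_1*s_2]=[s,s_2*s_1]$ denotes the image of $[s,s_1\times s_2]^{(0)}$. The cells of $G^{(0)}$ are: the $0$-cells $Z_{st}^s=Z_{ts}^s=[v_s,v_s*v_t]$ for $(v_s,v_t)\in E(G)$, and $W_{st}^u=W_{ts}^u=[v_u,v_s*v_t]$ for $(v_u,v_s),(v_u,v_t)\in E(G)$, $v_s\ne v_t$; the $1$-cells $X_{st}^i=X_{ts}^i=[e_i,v_s*v_t]$ for $e_i=(v_s,v_t)\in E(G)$, and $Y_{ti}^s=[v_s,v_t*e_i]$ for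 $(v_s,v_t),e_i\in E(G)$, $(v_s,v_t)\ne e_i$, $v_s\subset e_i$. Both $X_{st}^i$ and $Y_{ti}^s$ are oriented by the orientation of $e_i$. The dual $1$-cochains of $X_{st}^i$ and $Y_{ti}^s$ are denoted $X_i^{st}$ and $Y_s^{ti}$. *)

theory Defs
  imports "HOL-Algebra.Algebra" "HOL-Library.Extended_Real"
begin

section \<open>Graphs\<close>

text \<open>A graph is a vertex set \<open>V\<close> together with a set \<open>E\<close> of two-element subsets of \<open>V\<close>.\<close>

definition finite_simple_graph :: "'v set \<Rightarrow> 'v set set \<Rightarrow> bool" where
  "finite_simple_graph V E \<longleftrightarrow> finite V \<and> (\<forall>x\<in>E. x \<subseteq> V \<and> card x = 2)"

definition connected_graph :: "'v set \<Rightarrow> 'v set set \<Rightarrow> bool" where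
  "connected_graph V E \<longleftrightarrow>
     V \<noteq> {} \<and> (\<forall>u\<in>V. \<forall>w\<in>V. (u, w) \<in> {(a, b). {a, b} \<in> E}\<^sup>*)"

definition graph_cycle :: "'v set set \<Rightarrow> 'v list \<Rightarrow> bool" where
  "graph_cycle E p \<longleftrightarrow>
     length p \<ge> 3 \<and> distinct p \<and>
     (\<forall>i<length p. {p ! i, p ! (Suc i mod length p)} \<in> E)"

definition spanning_tree :: "'v set \<Rightarrow> 'v set set \<Rightarrow> 'v set set \<Rightarrow> bool" where
  "spanning_tree V E T \<longleftrightarrow> T \<subseteq> E \<and> connected_graph V T \<and> (\<nexists>p. graph_cycle T p)"

definition vdeg :: "'v set set \<Rightarrow> 'v \<Rightarrow> nat" where
  "vdeg E u = card {x \<in> E. u \<in> x}"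

definition orientation :: "'v set set \<Rightarrow> ('v set \<Rightarrow> 'v) \<Rightarrow> ('v set \<Rightarrow> 'v) \<Rightarrow> bool" where
  "orientation E src tgt \<longleftrightarrow> (\<forall>x\<in>E. x = {src x, tgt x})"

section \<open>The tube and the symmetric tube\<close>

text \<open>
  A simplex (vertex or closed edge) is represented by its set of vertices. Two simplices of a
  simple graph are disjoint as subspaces iff their vertex sets are disjoint, and a union of
  simplices lies in a vertex or a closed edge iff its vertex set does. The triple
  \<open>(s, s1, s2)\<close> stands for the cell $[s, s_1 \times s_2]^{(0)}$, which is homeomorphic to
  $s \times s_1 \times s_2$.
\<close>

definition simplices :: "'v set \<Rightarrow> 'v set set \<Rightarrow> 'v set set" where
  "simplices V E = {{u} |u. u \<in> V} \<union> E"

type_synonym 'v tube_cell = "'v set \<times> 'v set \<times> 'v set"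

definition tube :: "'v set \<Rightarrow> 'v set set \<Rightarrow> 'v tube_cell set" where
  "tube V E = {(s, s1, s2).
     s \<in> simplices V E \<and> s1 \<in> simplices V E \<and> s2 \<in> simplices V E \<and> s1 \<inter> s2 = {} \<and>
     (\<exists>x\<in>simplices V E. s \<union> s1 \<subseteq> x) \<and> (\<exists>x\<in>simplices V E. s \<union> s2 \<subseteq> x)}"

definition simplex_dim :: "'v set \<Rightarrow> nat" where
  "simplex_dim s = card s - 1"

fun cell_dim :: "'v tube_cell \<Rightarrow> nat" where
  "cell_dim (s, s1, s2) = simplex_dim s + simplex_dim s1 + simplex_dim s2"

definition tube_cells :: "'v set \<Rightarrow> 'v set set \<Rightarrow> nat \<Rightarrow> 'v tube_cell set" where
  "tube_cells V E k = {c \<in> tube V E. cell_dim c = k}"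

text \<open>The generator of the $\mathbb{Z}_2$-action; the cells of the symmetric tube are the
  orbits, \<open>[s, s1*s2]\<close> being the orbit of \<open>(s, s1, s2)\<close>.\<close>

fun exchange :: "'v tube_cell \<Rightarrow> 'v tube_cell" where
  "exchange (s, s1, s2) = (s, s2, s1)"

definition z2_orbit :: "'v tube_cell \<Rightarrow> 'v tube_cell set" where
  "z2_orbit c = {c, exchange c}"

definition sym_cells :: "'v set \<Rightarrow> 'v set set \<Rightarrow> nat \<Rightarrow> 'v tube_cell set set" where
  "sym_cells V E k = z2_orbit ` tube_cells V E k"

abbreviation sym_cell :: "'v set \<Rightarrow> 'v set \<Rightarrow> 'v set \<Rightarrow> 'v tube_cell set" where
  "sym_cell s s1 s2 \<equiv> z2_orbit (s, s1, s2)"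

section \<open>Cellular cohomology with integer coefficients\<close>

text \<open>Incidence numbers: simplicial ones for the oriented edges, and for the cells of the tube
  those given by the Leibniz rule for $s \times s_1 \times s_2$ with the product orientation.\<close>

definition simplex_inc :: "('v set \<Rightarrow> 'v) \<Rightarrow> ('v set \<Rightarrow> 'v) \<Rightarrow> 'v set \<Rightarrow> 'v set \<Rightarrow> int" where
  "simplex_inc src tgt s t =
     (if card s = 2 then of_bool (t = {tgt s}) - of_bool (t = {src s}) else 0)"

fun cell_inc ::
  "('v set \<Rightarrow> 'v) \<Rightarrow> ('v set \<Rightarrow> 'v) \<Rightarrow> 'v tube_cell \<Rightarrow> 'v tube_cell \<Rightarrow> int" where
  "cell_inc src tgt (s, s1, s2) (t, t1, t2) =
     simplex_inc src tgt s t * of_bool (s1 = t1 \<and> s2 = t2)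
     + (-1) ^ simplex_dim s * simplex_inc src tgt s1 t1 * of_bool (s = t \<and> s2 = t2)
     + (-1) ^ (simplex_dim s + simplex_dim s1) * simplex_inc src tgt s2 t2
         * of_bool (s = t \<and> s1 = t1)"

definition tube_coboundary ::
  "'v set \<Rightarrow> 'v set set \<Rightarrow> ('v set \<Rightarrow> 'v) \<Rightarrow> ('v set \<Rightarrow> 'v) \<Rightarrow> nat
   \<Rightarrow> ('v tube_cell \<Rightarrow> int) \<Rightarrow> 'v tube_cell \<Rightarrow> int" where
  "tube_coboundary V E src tgt k f c = (\<Sum>c'\<in>tube_cells V E k. cell_inc src tgt c c' * f c')"

definition cochains :: "'v set \<Rightarrow> 'v set set \<Rightarrow> nat \<Rightarrow> ('v tube_cell set \<Rightarrow> int) monoid" where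
  "cochains V E k = product_group (sym_cells V E k) (\<lambda>_. integer_group)"

text \<open>
  The coboundary on the quotient: pull back to the tube, take the coboundary there, and
  evaluate it on a cell of the orbit. The choice of the cell does not matter
  (\<open>coboundary_orbit\<close> below): all cells have dimension at most 1, so exchanging the
  factors preserves the product orientations.
\<close>

definition coboundary ::
  "'v set \<Rightarrow> 'v set set \<Rightarrow> ('v set \<Rightarrow> 'v) \<Rightarrow> ('v set \<Rightarrow> 'v) \<Rightarrow> nat
   \<Rightarrow> ('v tube_cell set \<Rightarrow> int) \<Rightarrow> 'v tube_cell set \<Rightarrow> int" where
  "coboundary V E src tgt k f =
     (\<lambda>q\<in>sym_cells V E (Suc k). tube_coboundary V E src tgt k (f \<circ> z2_orbit) (SOME c. c \<in> q))"

definition cocycle_group ::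
  "'v set \<Rightarrow> 'v set set \<Rightarrow> ('v set \<Rightarrow> 'v) \<Rightarrow> ('v set \<Rightarrow> 'v) \<Rightarrow> nat
   \<Rightarrow> ('v tube_cell set \<Rightarrow> int) monoid" where
  "cocycle_group V E src tgt k =
     subgroup_generated (cochains V E k)
       (kernel (cochains V E k) (cochains V E (Suc k)) (coboundary V E src tgt k))"

definition coboundaries ::
  "'v set \<Rightarrow> 'v set set \<Rightarrow> ('v set \<Rightarrow> 'v) \<Rightarrow> ('v set \<Rightarrow> 'v) \<Rightarrow> nat
   \<Rightarrow> ('v tube_cell set \<Rightarrow> int) set" where
  "coboundaries V E src tgt k =
     (case k of 0 \<Rightarrow> {\<one>\<^bsub>cochains V E 0\<^esub>}
      | Suc j \<Rightarrow> coboundary V E src tgt j ` carrier (cochains V E j))"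

definition cohomology ::
  "'v set \<Rightarrow> 'v set set \<Rightarrow> ('v set \<Rightarrow> 'v) \<Rightarrow> ('v set \<Rightarrow> 'v) \<Rightarrow> nat
   \<Rightarrow> ('v tube_cell set \<Rightarrow> int) set monoid" where
  "cohomology V E src tgt k =
     cocycle_group V E src tgt k Mod coboundaries V E src tgt k"

definition cohomology_class ::
  "'v set \<Rightarrow> 'v set set \<Rightarrow> ('v set \<Rightarrow> 'v) \<Rightarrow> ('v set \<Rightarrow> 'v) \<Rightarrow> nat
   \<Rightarrow> ('v tube_cell set \<Rightarrow> int) \<Rightarrow> ('v tube_cell set \<Rightarrow> int) set" where
  "cohomology_class V E src tgt k f =
     coboundaries V E src tgt k #>\<^bsub>cocycle_group V E src tgt k\<^esub> f"

definition dual_cochain ::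
  "'v set \<Rightarrow> 'v set set \<Rightarrow> nat \<Rightarrow> 'v tube_cell set \<Rightarrow> 'v tube_cell set \<Rightarrow> int" where
  "dual_cochain V E k c = (\<lambda>q\<in>sym_cells V E k. of_bool (q = c))"

text \<open>The infinite cyclic groups of the statement: the subgroup of $H^1$ generated by the class
  of the cochain dual to a 1-cell.\<close>

definition dual_class_group ::
  "'v set \<Rightarrow> 'v set set \<Rightarrow> ('v set \<Rightarrow> 'v) \<Rightarrow> ('v set \<Rightarrow> 'v) \<Rightarrow> 'v tube_cell set
   \<Rightarrow> ('v tube_cell set \<Rightarrow> int) set monoid" where
  "dual_class_group V E src tgt c =
     subgroup_generated (cohomology V E src tgt 1)
       {cohomology_class V E src tgt 1 (dual_cochain V E 1 c)}"

text \<open>The rank of an abelian group, with value \<open>\<infinity>\<close> if there is no largest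
  finite independent set.\<close>

definition int_independent :: "('a, 'b) monoid_scheme \<Rightarrow> 'a set \<Rightarrow> bool" where
  "int_independent G S \<longleftrightarrow> finite S \<and> S \<subseteq> carrier G \<and>
     (\<forall>a :: 'a \<Rightarrow> int. finprod G (\<lambda>x. x [^]\<^bsub>G\<^esub> a x) S = \<one>\<^bsub>G\<^esub> \<longrightarrow> (\<forall>x\<in>S. a x = 0))"

definition abelian_rank :: "('a, 'b) monoid_scheme \<Rightarrow> enat" where
  "abelian_rank G = (SUP S\<in>{S. int_independent G S}. enat (card S))"

section \<open>Consistency of the definitions\<close>

lemma exchange_exchange [simp]: "exchange (exchange c) = c"
  by (cases c) auto

lemma z2_orbit_exchange [simp]: "z2_orbit (exchange c) = z2_orbit c"
  by (auto simp: z2_orbit_def)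

lemma exchange_tube_cells: "exchange c \<in> tube_cells V E k \<longleftrightarrow> c \<in> tube_cells V E k"
  by (cases c) (auto simp: tube_cells_def tube_def)

lemma exchange_free: "c \<in> tube V E \<Longrightarrow> finite_simple_graph V E \<Longrightarrow> exchange c \<noteq> c"
  by (cases c) (auto simp: tube_def simplices_def finite_simple_graph_def)

lemma tube_dim_le_1:
  assumes "finite_simple_graph V E" "c \<in> tube V E"
  shows "cell_dim c \<le> 1"
proof -
  obtain s s1 s2 where c: "c = (s, s1, s2)" by (cases c) auto
  have simplex: "card x \<le> 2 \<and> card x \<ge> 1 \<and> finite x" if "x \<in> simplices V E" for x
    using that assms(1) by (force simp: simplices_def finite_simple_graph_def intro: card_ge_0_finite)
  have S: "s \<in> simplices V E" "s1 \<in> simplices V E" "s2 \<in> simplices V E" "s1 \<inter> s2 = {}"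
    using assms(2) by (auto simp: c tube_def)
  obtain x1 x2 where x: "x1 \<in> simplices V E" "s \<union> s1 \<subseteq> x1" "x2 \<in> simplices V E" "s \<union> s2 \<subseteq> x2"
    using assms(2) by (auto simp: c tube_def)
  have full: "y = z" if "y \<subseteq> z" "z \<in> simplices V E" "card y = 2" for y z
    using that simplex[of z] card_seteq[of z y] by simp
  have ne: "s \<noteq> {}" "s1 \<noteq> {}" "s2 \<noteq> {}"
    using S simplex by fastforce+
  have "\<not> (card s1 = 2 \<and> card s = 2)"
    using full[of s x1] full[of s x2] full[of s1 x1] x S(4) ne by blast
  moreover have "\<not> (card s2 = 2 \<and> card s = 2)"
    using full[of s x1] full[of s x2] full[of s2 x2] x S(4) ne by blast
  moreover have "\<not> (card s1 = 2 \<and> card s2 = 2)"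
    using full[of s1 x1] full[of s2 x2] x S(4) ne by blast
  ultimately show ?thesis
    using simplex[OF S(1)] simplex[OF S(2)] simplex[OF S(3)]
    by (auto simp: c simplex_dim_def)
qed

lemma cell_inc_exchange:
  assumes "cell_dim c \<le> 1"
  shows "cell_inc src tgt (exchange c) (exchange c') = cell_inc src tgt c c'"
proof -
  obtain s s1 s2 where c: "c = (s, s1, s2)" by (cases c) auto
  obtain t t1 t2 where c': "c' = (t, t1, t2)" by (cases c') auto
  have "simplex_inc src tgt s1 t1 = 0 \<or> (simplex_dim s = 0 \<and> simplex_dim s2 = 0)"
    "simplex_inc src tgt s2 t2 = 0 \<or> (simplex_dim s = 0 \<and> simplex_dim s1 = 0)"
    using assms by (auto simp: c simplex_inc_def simplex_dim_def)
  then show ?thesis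
    by (auto simp: c c' conj_commute)
qed

lemma tube_coboundary_exchange:
  assumes "cell_dim c \<le> 1"
  shows "tube_coboundary V E src tgt k (f \<circ> z2_orbit) (exchange c)
           = tube_coboundary V E src tgt k (f \<circ> z2_orbit) c"
proof -
  have "bij_betw exchange (tube_cells V E k) (tube_cells V E k)"
    by (rule bij_betwI[where g = exchange]) (auto simp: exchange_tube_cells)
  then have "tube_coboundary V E src tgt k (f \<circ> z2_orbit) (exchange c)
      = (\<Sum>c'\<in>tube_cells V E k.
           cell_inc src tgt (exchange c) (exchange c') * (f \<circ> z2_orbit) (exchange c'))"
    unfolding tube_coboundary_def by (rule sum.reindex_bij_betw[symmetric])
  then show ?thesis
    by (simp add: tube_coboundary_def cell_inc_exchange[OF assms])
qed

lemma coboundary_orbit: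
  assumes "finite_simple_graph V E" "c \<in> tube_cells V E (Suc k)"
  shows "coboundary V E src tgt k f (z2_orbit c) = tube_coboundary V E src tgt k (f \<circ> z2_orbit) c"
proof -
  have "cell_dim c \<le> 1"
    using assms tube_dim_le_1[of V E c] by (simp add: tube_cells_def)
  moreover have "(SOME c'. c' \<in> z2_orbit c) \<in> z2_orbit c"
    by (rule someI[of _ c]) (simp add: z2_orbit_def)
  moreover have "z2_orbit c \<in> sym_cells V E (Suc k)"
    using assms(2) by (simp add: sym_cells_def)
  ultimately show ?thesis
    using tube_coboundary_exchange[of c V E src tgt k f]
    unfolding coboundary_def restrict_apply by (metis z2_orbit_def insertE singletonD)
qed

end

theory Submission
  imports Defs
begin

text \<open>
  The symmetric tube is a graph \<open>\<Gamma>\<close>, because all its cells have dimension at most 1. So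
  every 1-cochain is a cocycle, and $H^1$ is the group of all 1-cochains modulo the image of the
  coboundary. For a finite connected graph, the classes of the cochains dual to the edges outside a
  spanning tree form a basis of this quotient. The proof exhibits a spanning tree of \<open>\<Gamma>\<close> whose
  complement consists of the 1-cells in the statement.

  The shape of \<open>\<Gamma>\<close> suggests the tree. The cells with first component a fixed vertex \<open>u\<close> of
  degree \<open>d\<close> form the barycentric subdivision of the complete graph on the neighbours of \<open>u\<close>: the
  vertex \<open>a\<close> is $[u, a * u]$, the midpoint of the edge $ab$ is $[u, a * b]$, and the half edge
  from \<open>a\<close> to this midpoint is $[u, a * (u,b)]$. The remaining 1-cells $[x, a * b]$, one for each
  edge $x = (a,b)$, connect these pieces as the edges of \<open>G\<close> connect its vertices. In the
  complete graph on \<open>1, \<dots>, d\<close> the star at \<open>d\<close> is a spanning tree. In the subdivision, one deletes for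
  each edge $jk$ with $j < k < d$ the half edge at \<open>j\<close>, and keeps the other half hanging on the star.
  The stars, the remaining halves and the cells over the edges of the spanning tree of \<open>G\<close>
  together form the spanning tree of \<open>\<Gamma>\<close>.

  The spanning tree is used only through two statements about cochains. Connectedness is
  \<open>coboundary_zero_if_zero_off_basis\<close>: if a coboundary vanishes on the tree, then it vanishes. This makes the
  classes independent. Acyclicity is \<open>coboundary_prescribed_off_basis\<close>: any values on the tree are
  those of a coboundary. This makes the classes span, since subtracting such a coboundary from a
  cochain leaves a combination of duals of the deleted cells. Both together give
  \<open>int_basis_cls\<close>. What remains is general: a finite basis of an abelian group yields the
  decomposition into infinite cyclic groups (\<open>int_basis_direct_sum\<close>) and the rank
  (\<open>int_basis_rank\<close>). Finally the number of basis cells is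
  $n - (m - 1) + \sum_s (d_s - 1)(d_s - 2)/2$, which equals the asserted rank because
  $\sum_s d_s = 2n$.
\<close>

section \<open>Integer relations\<close>

text \<open>
  Two cardinality bounds below come from this fact: the bound for independent sets in a group with
  a finite basis, and the number of edges of a tree. Gaussian elimination with cross multiplication
  in place of division keeps the solution integral.
\<close>

lemma integer_relation:
  fixes M :: "'a \<Rightarrow> 'b \<Rightarrow> int"
  assumes "finite B" "finite S" "card B < card S"
  shows "\<exists>a. (\<exists>s\<in>S. a s \<noteq> 0) \<and> (\<forall>b\<in>B. (\<Sum>s\<in>S. a s * M s b) = 0)"
  using assms
proof (induction B arbitrary: S M rule: finite_induct)
  case empty
  then have "S \<noteq> {}" by auto
  then show ?case by (intro exI[of _ "\<lambda>_. 1"]) auto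
next
  case (insert b B)
  show ?case
  proof (cases "\<forall>s\<in>S. M s b = 0")
    case True
    obtain a where "\<exists>s\<in>S. a s \<noteq> 0" "\<forall>b\<in>B. (\<Sum>s\<in>S. a s * M s b) = 0"
      using insert.IH[of S M] insert.prems insert.hyps by auto
    with True show ?thesis by (intro exI[of _ a]) auto
  next
    case False
    then obtain p where p: "p \<in> S" "M p b \<noteq> 0" by auto
    \<comment> \<open>Gaussian elimination of the equation \<open>b\<close> with pivot \<open>p\<close>.\<close>
    define M' where "M' s c = M p b * M s c - M s b * M p c" for s c
    have "card B < card (S - {p})" "finite (S - {p})"
      using insert.prems insert.hyps p by auto
    then obtain a' where a': "\<exists>s\<in>S-{p}. a' s \<noteq> 0" "\<forall>c\<in>B. (\<Sum>s\<in>S-{p}. a' s * M' s c) = 0"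
      using insert.IH[of "S - {p}" M'] by auto
    define a where "a s = (if s = p then - (\<Sum>s\<in>S-{p}. a' s * M s b) else M p b * a' s)" for s
    have sum: "(\<Sum>s\<in>S. a s * M s c) = (\<Sum>s\<in>S-{p}. a' s * M' s c)" for c
    proof -
      have "(\<Sum>s\<in>S. a s * M s c) = a p * M p c + (\<Sum>s\<in>S-{p}. a s * M s c)"
        using insert.prems p by (simp add: sum.remove)
      also have "(\<Sum>s\<in>S-{p}. a s * M s c) = (\<Sum>s\<in>S-{p}. M p b * a' s * M s c)"
        by (intro sum.cong) (auto simp: a_def)
      moreover have "a p * M p c = - (\<Sum>s\<in>S-{p}. a' s * M s b * M p c)"
        by (simp add: a_def sum_distrib_right)
      ultimately show ?thesis
        by (simp add: M'_def sum_subtractf algebra_simps)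
    qed
    have "(\<Sum>s\<in>S. a s * M s b) = 0"
      unfolding sum by (simp add: M'_def)
    moreover have "\<exists>s\<in>S. a s \<noteq> 0"
      using a'(1) p by (auto simp: a_def)
    ultimately show ?thesis using a'(2) sum by (intro exI[of _ a]) auto
  qed
qed

section \<open>Finite bases of abelian groups\<close>

context comm_group
begin

definition lincomb :: "('i \<Rightarrow> 'a) \<Rightarrow> 'i set \<Rightarrow> ('i \<Rightarrow> int) \<Rightarrow> 'a" where
  "lincomb b I c = finprod G (\<lambda>i. b i [^] c i) I"

definition int_basis :: "('i \<Rightarrow> 'a) \<Rightarrow> 'i set \<Rightarrow> bool" where
  "int_basis b I \<longleftrightarrow> finite I \<and> b \<in> I \<rightarrow> carrier G \<and>
     (\<forall>x\<in>carrier G. \<exists>c. x = lincomb b I c) \<and>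
     (\<forall>c. lincomb b I c = \<one> \<longrightarrow> (\<forall>i\<in>I. c i = 0))"

lemma int_basisD:
  assumes "int_basis b I"
  shows "finite I" "\<And>i. i \<in> I \<Longrightarrow> b i \<in> carrier G"
    "\<And>x. x \<in> carrier G \<Longrightarrow> \<exists>c. x = lincomb b I c"
    "\<And>c i. lincomb b I c = \<one> \<Longrightarrow> i \<in> I \<Longrightarrow> c i = 0"
  using assms by (auto simp: int_basis_def)

lemma lincomb_closed [simp]: "b \<in> I \<rightarrow> carrier G \<Longrightarrow> lincomb b I c \<in> carrier G"
  unfolding lincomb_def by (intro finprod_closed) auto

lemma lincomb_add:
  assumes "b \<in> I \<rightarrow> carrier G"
  shows "lincomb b I (\<lambda>i. c i + c' i) = lincomb b I c \<otimes> lincomb b I c'"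
proof -
  have "lincomb b I (\<lambda>i. c i + c' i) = finprod G (\<lambda>i. b i [^] c i \<otimes> b i [^] c' i) I"
    unfolding lincomb_def using assms by (intro finprod_cong') (auto simp: int_pow_mult Pi_iff)
  also have "\<dots> = lincomb b I c \<otimes> lincomb b I c'"
    unfolding lincomb_def using assms by (intro finprod_multf) auto
  finally show ?thesis .
qed

lemma lincomb_pow:
  assumes "finite I" "b \<in> I \<rightarrow> carrier G"
  shows "lincomb b I (\<lambda>i. k * c i) = lincomb b I c [^] (k::int)"
  using assms unfolding lincomb_def
proof (induction I rule: finite_induct)
  case (insert i I)
  then have b: "b i \<in> carrier G" "b \<in> I \<rightarrow> carrier G" by auto
  then have *: "(\<lambda>i. b i [^] c i) \<in> I \<rightarrow> carrier G" "(\<lambda>i. b i [^] (k * c i)) \<in> I \<rightarrow> carrier G"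
    by auto
  show ?case
    using insert b * by (simp add: int_pow_distrib int_pow_pow mult.commute)
qed simp

lemma lincomb_zero [simp]: "lincomb b I (\<lambda>_. 0) = \<one>"
  by (simp add: lincomb_def)

lemma lincomb_sum:
  assumes "finite S" "b \<in> I \<rightarrow> carrier G"
  shows "lincomb b I (\<lambda>i. \<Sum>s\<in>S. F s i) = finprod G (\<lambda>s. lincomb b I (F s)) S"
  using assms(1) by induction (simp_all add: lincomb_add assms(2))

lemma lincomb_single:
  assumes "finite I" "b \<in> I \<rightarrow> carrier G" "i \<in> I"
  shows "lincomb b I (\<lambda>j. if j = i then k else 0) = b i [^] (k::int)"
proof -
  have "lincomb b I (\<lambda>j. if j = i then k else 0)
      = finprod G (\<lambda>j. if i = j then b j [^] k else \<one>) I"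
    unfolding lincomb_def using assms by (intro finprod_cong') (auto simp: Pi_iff)
  also have "\<dots> = b i [^] k"
    using assms by (intro finprod_singleton) (auto simp: Pi_iff)
  finally show ?thesis .
qed

lemma lincomb_inject:
  assumes "int_basis b I" "lincomb b I c = lincomb b I c'" "i \<in> I"
  shows "c i = c' i"
proof -
  note b = int_basisD[OF assms(1)]
  have bI: "b \<in> I \<rightarrow> carrier G" using b(2) by auto
  have "lincomb b I (\<lambda>i. c i - c' i) \<otimes> lincomb b I c' = lincomb b I c'"
    using lincomb_add[OF bI, of "\<lambda>i. c i - c' i" c'] assms(2) by simp
  then have "lincomb b I (\<lambda>i. c i - c' i) = \<one>"
    using bI by (simp add: r_cancel_one)
  then show ?thesis using b(4)[OF _ assms(3)] by fastforce
qed

lemma int_basis_pow_inject: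
  assumes "int_basis b I" "i \<in> I" "b i [^] k = b i [^] (l::int)"
  shows "k = l"
proof -
  note b = int_basisD[OF assms(1)]
  have "b \<in> I \<rightarrow> carrier G" using b(2) by auto
  from lincomb_single[OF b(1) this assms(2)] show ?thesis
    using lincomb_inject[OF assms(1), of "\<lambda>j. if j = i then k else 0" "\<lambda>j. if j = i then l else 0" i]
      assms(2,3) by simp
qed

lemma int_basis_cyclic:
  assumes "int_basis b I" "i \<in> I"
  shows "subgroup_generated G {b i} \<cong> integer_group"
proof -
  have c: "b i \<in> carrier G" using int_basisD(2)[OF assms] .
  have "(\<lambda>k::int. b i [^] k) \<in> iso integer_group (subgroup_generated G {b i})"
    using c int_basis_pow_inject[OF assms]
    by (auto simp: iso_def hom_def bij_betw_def inj_on_def int_pow_mult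
        carrier_subgroup_generated_by_singleton)
  then show ?thesis
    by (metis group.iso_sym group_integer_group is_isoI)
qed

text \<open>
  A basis is independent, which gives the lower bound. An independent set that is larger than the
  basis would satisfy the relation that \<open>integer_relation\<close> finds for its coordinate vectors.
\<close>

lemma int_basis_rank:
  assumes "int_basis b I"
  shows "abelian_rank G = enat (card I)"
proof -
  note b = int_basisD[OF assms(1)]
  have bI: "b \<in> I \<rightarrow> carrier G" using b(2) by auto
  have inj: "inj_on b I"
  proof (rule inj_onI, rule ccontr)
    fix i j assume ij: "i \<in> I" "j \<in> I" "b i = b j" "i \<noteq> j"
    have "lincomb b I (\<lambda>k. if k = i then 1 else 0) = lincomb b I (\<lambda>k. if k = j then 1 else 0)"
      using lincomb_single[OF b(1) bI] ij by simp
    from lincomb_inject[OF assms this ij(1)] show False using ij by simp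
  qed
  have ind: "int_independent G (b ` I)"
    unfolding int_independent_def
  proof (intro conjI allI impI ballI)
    fix a :: "'a \<Rightarrow> int" and x
    assume *: "finprod G (\<lambda>x. x [^] a x) (b ` I) = \<one>" and "x \<in> b ` I"
    then obtain i where i: "i \<in> I" "x = b i" by auto
    have "finprod G (\<lambda>x. x [^] a x) (b ` I) = lincomb b I (a \<circ> b)"
      unfolding lincomb_def using inj bI by (subst finprod_reindex) auto
    with * b(4)[of "a \<circ> b" i] i show "a x = 0" by simp
  qed (use b in auto)
  have le: "card S \<le> card I" if S: "int_independent G S" for S
  proof (rule ccontr)
    assume "\<not> card S \<le> card I"
    have fS: "finite S" "S \<subseteq> carrier G" using S by (auto simp: int_independent_def)
    obtain M where M: "\<And>s. s \<in> S \<Longrightarrow> s = lincomb b I (M s)"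
      using b(3) fS by (metis subsetD)
    obtain a where a: "\<exists>s\<in>S. a s \<noteq> 0" "\<forall>i\<in>I. (\<Sum>s\<in>S. a s * M s i) = 0"
      using integer_relation[OF b(1) fS(1), of M] \<open>\<not> card S \<le> card I\<close> by auto
    have "finprod G (\<lambda>s. s [^] a s) S = finprod G (\<lambda>s. lincomb b I (\<lambda>i. a s * M s i)) S"
    proof (intro finprod_cong' refl)
      fix s assume "s \<in> S"
      then show "s [^] a s = lincomb b I (\<lambda>i. a s * M s i)"
        using M[of s] lincomb_pow[OF b(1) bI, of "a s" "M s"] by simp
    qed (use bI in auto)
    also have "\<dots> = lincomb b I (\<lambda>i. \<Sum>s\<in>S. a s * M s i)"
      by (rule lincomb_sum[OF fS(1) bI, symmetric])
    also have "\<dots> = lincomb b I (\<lambda>_. 0)"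
      unfolding lincomb_def using a(2) bI by (intro finprod_cong') (auto simp: Pi_iff)
    finally show False using S a(1) by (auto simp: int_independent_def)
  qed
  show ?thesis unfolding abelian_rank_def
  proof (rule antisym)
    show "(SUP S\<in>{S. int_independent G S}. enat (card S)) \<le> enat (card I)"
      using le by (intro SUP_least) auto
    have "enat (card I) = enat (card (b ` I))" using inj by (simp add: card_image)
    also have "\<dots> \<le> (SUP S\<in>{S. int_independent G S}. enat (card S))"
      using ind by (intro SUP_upper) auto
    finally show "enat (card I) \<le> (SUP S\<in>{S. int_independent G S}. enat (card S))" .
  qed
qed

lemma lincomb_Plus_Sigma:
  assumes "finite J" "finite K" "\<And>k. k \<in> K \<Longrightarrow> finite (L k)"
    and "b \<in> J <+> Sigma K L \<rightarrow> carrier G"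
  shows "lincomb b (J <+> Sigma K L) c =
    finprod G (\<lambda>j. b (Inl j) [^] c (Inl j)) J \<otimes>
    finprod G (\<lambda>k. finprod G (\<lambda>l. b (Inr (k, l)) [^] c (Inr (k, l))) (L k)) K"
proof -
  let ?f = "\<lambda>i. b i [^] c i"
  have f: "?f (Inl j) \<in> carrier G" if "j \<in> J" for j using that assms(4) by auto
  have f': "?f (Inr (k, l)) \<in> carrier G" if "k \<in> K" "l \<in> L k" for k l using that assms(4) by auto
  have "lincomb b (J <+> Sigma K L) c = finprod G ?f (Inl ` J) \<otimes> finprod G ?f (Inr ` Sigma K L)"
    unfolding lincomb_def Plus_def using assms f f'
    by (intro finprod_Un_disjoint) auto
  also have "finprod G ?f (Inl ` J) = finprod G (\<lambda>j. ?f (Inl j)) J"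
    using f by (intro finprod_reindex) auto
  also have "finprod G ?f (Inr ` Sigma K L) = finprod G (\<lambda>p. ?f (Inr p)) (Sigma K L)"
    using f' by (intro finprod_reindex) auto
  also have "finprod G (\<lambda>p. ?f (Inr p)) (Sigma K L)
      = finprod G (\<lambda>p. ?f (Inr p)) (\<Union>k\<in>K. Pair k ` L k)"
    by (rule arg_cong[where f = "finprod G _"]) auto
  also have "\<dots> = finprod G (\<lambda>k. finprod G (\<lambda>p. ?f (Inr p)) (Pair k ` L k)) K"
    using assms f' by (intro finprod_UN_disjoint) (auto simp: pairwise_def disjnt_def)
  also have "\<dots> = finprod G (\<lambda>k. finprod G (\<lambda>l. ?f (Inr (k, l))) (L k)) K"
  proof (intro finprod_cong' refl)
    fix k assume "k \<in> K"
    then show "finprod G (\<lambda>p. ?f (Inr p)) (Pair k ` L k) = finprod G (\<lambda>l. ?f (Inr (k, l))) (L k)"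
      using f' by (subst finprod_reindex) (auto simp: inj_on_def)
  qed (use f' in \<open>auto intro!: finprod_closed\<close>)
  finally show ?thesis .
qed

text \<open>
  The index set is a disjoint sum because the decomposition in question groups the basis
  elements into one single family and one doubly indexed family.
\<close>

lemma int_basis_direct_sum:
  assumes K: "finite K" "\<And>k. k \<in> K \<Longrightarrow> finite (L k)" "finite J"
    and b: "int_basis b (J <+> Sigma K L)"
  shows "(\<lambda>(x, y). finprod G x J \<otimes> finprod G (\<lambda>k. finprod G (y k) (L k)) K)
     \<in> iso (sum_group J (\<lambda>j. subgroup_generated G {b (Inl j)}) \<times>\<times>
            sum_group K (\<lambda>k. sum_group (L k) (\<lambda>l. subgroup_generated G {b (Inr (k, l))}))) G"
    (is "?F \<in> iso (sum_group J ?A \<times>\<times> sum_group K (\<lambda>k. sum_group (L k) (?B k))) G")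
proof -
  let ?I = "J <+> Sigma K L"
  note bD = int_basisD[OF b]
  have bI: "b \<in> ?I \<rightarrow> carrier G" using bD(2) by auto
  have [simp]: "group (?A j)" "group (?B k l)" "group (sum_group (L k) (?B k))" for j k l
    by (auto intro: group_subgroup_generated sum_group)
  have A: "carrier (?A j) = range (\<lambda>n::int. b (Inl j) [^] n)" if "j \<in> J" for j
    using that bD(2)[of "Inl j"] by (subst carrier_subgroup_generated_by_singleton) (auto intro: InlI)
  have B: "carrier (?B k l) = range (\<lambda>n::int. b (Inr (k, l)) [^] n)" if "k \<in> K" "l \<in> L k" for k l
    using that bD(2)[of "Inr (k, l)"] by (subst carrier_subgroup_generated_by_singleton) (auto intro: InrI)
  have cB: "carrier (sum_group (L k) (?B k)) = (\<Pi>\<^sub>E l\<in>L k. carrier (?B k l))" if "k \<in> K" for k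
    using K(2)[OF that] by (auto simp: carrier_sum_group)
  have cA: "carrier (sum_group J ?A) = (\<Pi>\<^sub>E j\<in>J. carrier (?A j))"
    using K(3) by (auto simp: carrier_sum_group)
  have cK: "carrier (sum_group K (\<lambda>k. sum_group (L k) (?B k)))
      = (\<Pi>\<^sub>E k\<in>K. \<Pi>\<^sub>E l\<in>L k. carrier (?B k l))"
    using K(1) cB by (subst carrier_sum_group) (auto intro!: PiE_cong)
  let ?C = "carrier (sum_group J ?A \<times>\<times> sum_group K (\<lambda>k. sum_group (L k) (?B k)))"
  have C: "?C = (\<Pi>\<^sub>E j\<in>J. carrier (?A j)) \<times> (\<Pi>\<^sub>E k\<in>K. \<Pi>\<^sub>E l\<in>L k. carrier (?B k l))"
    by (simp add: cA cK)
  \<comment> \<open>Every element of the direct sum is a family of powers, which the map sends to \<open>lincomb\<close>.\<close>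
  define emb where "emb c = ((\<lambda>j\<in>J. b (Inl j) [^] (c (Inl j) :: int)),
      (\<lambda>k\<in>K. \<lambda>l\<in>L k. b (Inr (k, l)) [^] (c (Inr (k, l)) :: int)))" for c
  have emb_in: "emb c \<in> ?C" for c
    unfolding C by (auto simp: emb_def A B)
  have lc: "lincomb b ?I c =
    finprod G (\<lambda>j. b (Inl j) [^] c (Inl j)) J \<otimes>
    finprod G (\<lambda>k. finprod G (\<lambda>l. b (Inr (k, l)) [^] c (Inr (k, l))) (L k)) K" for c
    by (rule lincomb_Plus_Sigma) (use K bI in auto)
  have F_emb: "?F (emb c) = lincomb b ?I c" for c
    unfolding lc emb_def split_conv
    using bI by (intro arg_cong2[where f = "(\<otimes>)"] finprod_cong' refl) (auto intro!: finprod_closed finprod_cong')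
  have emb_ex: "\<exists>c. p = emb c" if "p \<in> ?C" for p
  proof -
    obtain x y where p: "p = (x, y)" by (cases p)
    have x: "x \<in> (\<Pi>\<^sub>E j\<in>J. carrier (?A j))" and y: "y \<in> (\<Pi>\<^sub>E k\<in>K. \<Pi>\<^sub>E l\<in>L k. carrier (?B k l))"
      using that unfolding C p by auto
    have "\<forall>j\<in>J. \<exists>n::int. x j = b (Inl j) [^] n"
      using x A by (fastforce simp: PiE_def Pi_def)
    then obtain c1 :: "_ \<Rightarrow> int" where c1: "\<And>j. j \<in> J \<Longrightarrow> x j = b (Inl j) [^] c1 j" by metis
    have "\<exists>n::int. y k l = b (Inr (k, l)) [^] n" if "k \<in> K" "l \<in> L k" for k l
    proof -
      have "y k \<in> (\<Pi>\<^sub>E l\<in>L k. carrier (?B k l))" using y that by auto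
      then have "y k l \<in> carrier (?B k l)" using that by auto
      then show ?thesis using B[OF that] by auto
    qed
    then obtain c2 :: "_ \<Rightarrow> _ \<Rightarrow> int"
      where c2: "\<And>k l. k \<in> K \<Longrightarrow> l \<in> L k \<Longrightarrow> y k l = b (Inr (k, l)) [^] c2 k l" by metis
    have "x = fst (emb (case_sum c1 (\<lambda>(k, l). c2 k l)))"
      using x c1 by (intro extensionalityI[of _ J]) (auto simp: emb_def PiE_def)
    moreover have "y = snd (emb (case_sum c1 (\<lambda>(k, l). c2 k l)))"
    proof (intro extensionalityI[of _ K])
      show "y \<in> extensional K" using y by (auto simp: PiE_def)
      fix k assume k: "k \<in> K"
      then have "y k \<in> extensional (L k)" using y by (auto simp: PiE_def Pi_def)
      then show "y k = snd (emb (case_sum c1 (\<lambda>(k, l). c2 k l))) k"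
        using c2 k by (intro extensionalityI[of _ "L k"]) (auto simp: emb_def)
    qed (auto simp: emb_def)
    ultimately show ?thesis unfolding p by (metis prod.collapse)
  qed
  define S where "S = sum_group J ?A \<times>\<times> sum_group K (\<lambda>k. sum_group (L k) (?B k))"
  define F where "F = ?F"
  have F: "F (emb c) = lincomb b ?I c" for c unfolding F_def by (rule F_emb)
  have S: "emb c \<in> carrier S" "\<And>p. p \<in> carrier S \<Longrightarrow> \<exists>c. p = emb c" for c
    unfolding S_def by (rule emb_in, rule emb_ex)
  have mult: "emb c \<otimes>\<^bsub>S\<^esub> emb c' = emb (\<lambda>i. c i + c' i)" for c c'
  proof -
    have "b (Inl j) \<in> carrier G" if "j \<in> J" for j using bI that by auto
    moreover have "b (Inr (k, l)) \<in> carrier G" if "k \<in> K" "l \<in> L k" for k l using bI that by auto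
    ultimately show ?thesis
      by (auto simp: S_def emb_def int_pow_mult intro!: restrict_ext)
  qed
  have "F \<in> hom S G"
  proof (rule homI)
    show "F p \<in> carrier G" if "p \<in> carrier S" for p
      using S(2)[OF that] bI by (auto simp: F)
    show "F (p \<otimes>\<^bsub>S\<^esub> q) = F p \<otimes> F q" if "p \<in> carrier S" "q \<in> carrier S" for p q
      using S(2)[OF that(1)] S(2)[OF that(2)] by (auto simp: F mult lincomb_add[OF bI])
  qed
  moreover have "inj_on F (carrier S)"
  proof (rule inj_onI)
    fix p q assume "p \<in> carrier S" "q \<in> carrier S" "F p = F q"
    then obtain c c' where c: "p = emb c" "q = emb c'" "lincomb b ?I c = lincomb b ?I c'"
      using S(2) F by metis
    have "c i = c' i" if "i \<in> ?I" for i using lincomb_inject[OF b c(3) that] .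
    then show "p = q" unfolding c emb_def
      by (intro arg_cong2[where f = Pair] restrict_ext) (simp_all add: InlI InrI)
  qed
  moreover have "F ` carrier S = carrier G"
  proof
    show "F ` carrier S \<subseteq> carrier G" using \<open>F \<in> hom S G\<close> by (auto simp: hom_def)
    show "carrier G \<subseteq> F ` carrier S"
    proof
      fix x assume "x \<in> carrier G"
      then obtain c where "x = F (emb c)" using bD(3) F by auto
      then show "x \<in> F ` carrier S" using S(1) by blast
    qed
  qed
  ultimately show ?thesis by (simp add: iso_def bij_betw_def S_def F_def)
qed

end

section \<open>Potentials on trees\<close>

lemma distinct_edge_path:
  assumes "(a, b) \<in> {(u, w). {u, w} \<in> T}\<^sup>*"
  shows "\<exists>p. p \<noteq> [] \<and> distinct p \<and> hd p = a \<and> last p = b \<and>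
    (\<forall>i. Suc i < length p \<longrightarrow> {p ! i, p ! Suc i} \<in> T)"
  using assms
proof (induction rule: rtrancl_induct)
  case base
  show ?case by (rule exI[of _ "[a]"]) auto
next
  case (step y z)
  then obtain p where p: "p \<noteq> []" "distinct p" "hd p = a" "last p = y"
    "\<And>i. Suc i < length p \<Longrightarrow> {p ! i, p ! Suc i} \<in> T"
    by blast
  show ?case
  proof (cases "z \<in> set p")
    case True
    then obtain k where k: "k < length p" "p ! k = z" by (auto simp: in_set_conv_nth)
    have "last (take (Suc k) p) = z" using k by (simp add: take_Suc_conv_app_nth)
    then show ?thesis
      using p k by (intro exI[of _ "take (Suc k) p"]) auto
  next
    case False
    have "{(p @ [z]) ! i, (p @ [z]) ! Suc i} \<in> T" if i: "Suc i < length (p @ [z])" for i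
    proof (cases "Suc i < length p")
      case True
      then show ?thesis using p(5) by (simp add: nth_append)
    next
      case False
      then have "i = length p - 1" "Suc i = length p" using i by auto
      then show ?thesis using p(1,4) step.hyps(2) by (auto simp: nth_append last_conv_nth)
    qed
    then show ?thesis
      using p False by (intro exI[of _ "p @ [z]"]) auto
  qed
qed

text \<open>
  A path between the ends of an edge that avoids the edge closes up to a cycle.
\<close>

lemma acyclic_edge_disconnects:
  assumes T: "\<nexists>p. graph_cycle T p" and x: "{a, b} \<in> T" "a \<noteq> b"
  shows "(a, b) \<notin> {(u, w). {u, w} \<in> T - {{a, b}}}\<^sup>*"
proof
  let ?R = "{(u, w). {u, w} \<in> T - {{a, b}}}"
  assume "(a, b) \<in> ?R\<^sup>*"
  then obtain p where p: "p \<noteq> []" "distinct p" "hd p = a" "last p = b"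
    "\<And>i. Suc i < length p \<Longrightarrow> {p ! i, p ! Suc i} \<in> T - {{a, b}}"
    using distinct_edge_path[of a b "T - {{a, b}}"] by blast
  have len: "length p \<ge> 3"
  proof (rule ccontr)
    assume "\<not> length p \<ge> 3"
    then consider "length p = 1" | "length p = 2" using length_greater_0_conv[of p] p(1) by linarith
    then show False
    proof cases
      case 1
      then show ?thesis using p x by (auto simp: length_Suc_conv)
    next
      case 2
      then show ?thesis using p(3,4) p(5)[of 0]
        by (auto simp: numeral_2_eq_2 length_Suc_conv)
    qed
  qed
  have "{p ! i, p ! (Suc i mod length p)} \<in> T" if "i < length p" for i
  proof (cases "Suc i < length p")
    case True
    then show ?thesis using p(5)[OF True] by auto
  next
    case False
    then have "Suc i = length p" "i = length p - 1" using that by auto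
    then show ?thesis
      using p x(1) by (auto simp: hd_conv_nth last_conv_nth insert_commute)
  qed
  then have "graph_cycle T p" using len p(2) by (auto simp: graph_cycle_def)
  then show False using T by blast
qed

text \<open>
  The edges of a forest can be added one at a time, and each new edge joins two components, whose
  potentials can be shifted against each other.
\<close>

lemma acyclic_potential:
  fixes F :: "'v set \<Rightarrow> int"
  assumes "finite T" "\<nexists>p. graph_cycle T p" "\<And>x. x \<in> T \<Longrightarrow> x = {src x, tgt x} \<and> src x \<noteq> tgt x"
  shows "\<exists>h. \<forall>x\<in>T. h (tgt x) - h (src x) = F x"
  using assms
proof (induction T rule: finite_induct)
  case (insert x T)
  let ?a = "src x" and ?b = "tgt x"
  have x: "x = {?a, ?b}" "?a \<noteq> ?b" using insert.prems(2)[of x] by auto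
  have "\<nexists>p. graph_cycle T p" using insert.prems(1) by (auto simp: graph_cycle_def)
  then obtain h where h: "\<And>y. y \<in> T \<Longrightarrow> h (tgt y) - h (src y) = F y"
    using insert.IH insert.prems(2) by blast
  let ?R = "{(u, w). {u, w} \<in> T}"
  have "(?a, ?b) \<notin> ?R\<^sup>*"
    using acyclic_edge_disconnects[OF insert.prems(1), of ?a ?b] x insert.hyps(2) by simp
  \<comment> \<open>Shifting the potential on the component of \<open>tgt x\<close> in the remaining edges leaves its
    differences along these edges unchanged and can give any difference along \<open>x\<close>.\<close>
  define C where "C = {w. (?b, w) \<in> ?R\<^sup>*}"
  have sym: "sym (?R\<^sup>*)" by (intro sym_rtrancl symI) (auto simp: insert_commute)
  have C: "?b \<in> C" "?a \<notin> C"
    using \<open>(?a, ?b) \<notin> ?R\<^sup>*\<close> sym by (auto simp: C_def dest: symD)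
  have C_iff: "tgt y \<in> C \<longleftrightarrow> src y \<in> C" if "y \<in> T" for y
  proof -
    have "{src y, tgt y} \<in> T" using insert.prems(2)[of y] that by auto
    then have "(src y, tgt y) \<in> ?R" "(tgt y, src y) \<in> ?R" by (auto simp: insert_commute)
    then show ?thesis unfolding C_def by (auto intro: rtrancl_into_rtrancl)
  qed
  define h' where "h' w = h w + (if w \<in> C then F x - (h ?b - h ?a) else 0)" for w
  have "h' (tgt y) - h' (src y) = F y" if "y \<in> insert x T" for y
    using that h[of y] C C_iff[of y] by (auto simp: h'_def)
  then show ?case by blast
qed simp

lemma connected_const:
  assumes "connected_graph V T" "\<And>a b. {a, b} \<in> T \<Longrightarrow> h a = h b" "u \<in> V" "w \<in> V"
  shows "h u = h w"
proof -
  have "(u, w) \<in> {(a, b). {a, b} \<in> T}\<^sup>*" using assms by (auto simp: connected_graph_def)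
  then show ?thesis by induction (auto dest: assms(2))
qed


text \<open>
  The incidence matrix with the row of one vertex \<open>\<rho>\<close> deleted is square. Indeed, a relation among the
  edges would contradict the existence of potentials on a forest, and a relation among the vertices
  other than \<open>\<rho>\<close> would be a nonconstant function with equal values at the ends of every edge.
\<close>

lemma spanning_tree_card:
  assumes "finite V" "finite T" "connected_graph V T" "\<nexists>p. graph_cycle T p"
    and T: "\<And>x. x \<in> T \<Longrightarrow> x = {src x, tgt x} \<and> src x \<noteq> tgt x \<and> src x \<in> V \<and> tgt x \<in> V"
  shows "card V = Suc (card T)"
proof -
  obtain \<rho> where \<rho>: "\<rho> \<in> V" using assms(3) by (auto simp: connected_graph_def)
  let ?W = "V - {\<rho>}"
  define M :: "'a set \<Rightarrow> 'a \<Rightarrow> int" where "M x w = of_bool (w = tgt x) - of_bool (w = src x)" for x w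
  have M: "(\<Sum>w\<in>?W. h w * M x w) = h (tgt x) - h (src x)" if "h \<rho> = 0" "x \<in> T" for h x
  proof -
    have "(\<Sum>w\<in>?W. h w * M x w) = (\<Sum>w\<in>V. h w * M x w)"
      using assms(1) that(1) by (intro sum.mono_neutral_left) auto
    also have "\<dots> = (\<Sum>w\<in>V. (if w = tgt x then h w else 0) - (if w = src x then h w else 0))"
      by (intro sum.cong) (auto simp: M_def)
    also have "\<dots> = h (tgt x) - h (src x)"
      using assms(1) T[OF that(2)] by (simp add: sum_subtractf)
    finally show ?thesis .
  qed
  have "card T \<le> card ?W"
  proof (rule ccontr)
    assume "\<not> card T \<le> card ?W"
    then obtain a x\<^sub>0 where a: "x\<^sub>0 \<in> T" "a x\<^sub>0 \<noteq> 0" "\<And>w. w \<in> ?W \<Longrightarrow> (\<Sum>x\<in>T. a x * M x w) = 0"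
      using integer_relation[of ?W T M] assms(1,2) by auto
    obtain h' where h': "\<And>x. x \<in> T \<Longrightarrow> h' (tgt x) - h' (src x) = (of_bool (x = x\<^sub>0) :: int)"
      using acyclic_potential[of T src tgt "\<lambda>x. of_bool (x = x\<^sub>0)"] assms(2,4) T by blast
    define h where "h w = h' w - h' \<rho>" for w
    have "a x\<^sub>0 = (\<Sum>x\<in>T. a x * of_bool (x = x\<^sub>0))"
      using assms(2) a(1) by simp
    also have "\<dots> = (\<Sum>x\<in>T. a x * (\<Sum>w\<in>?W. h w * M x w))"
      using h' by (intro sum.cong refl) (simp add: M h_def)
    also have "\<dots> = (\<Sum>w\<in>?W. h w * (\<Sum>x\<in>T. a x * M x w))"
      unfolding sum_distrib_left by (subst sum.swap) (simp add: mult.left_commute)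
    also have "\<dots> = 0" using a(3) by simp
    finally show False using a(2) by simp
  qed
  moreover have "card ?W \<le> card T"
  proof (rule ccontr)
    assume "\<not> card ?W \<le> card T"
    then obtain a w\<^sub>0 where a: "w\<^sub>0 \<in> ?W" "a w\<^sub>0 \<noteq> 0" "\<And>x. x \<in> T \<Longrightarrow> (\<Sum>w\<in>?W. a w * M x w) = 0"
      using integer_relation[of T ?W "\<lambda>w x. M x w"] assms(1,2) by auto
    define h where "h w = (if w = \<rho> then 0 else a w)" for w
    have h: "h (tgt x) = h (src x)" if "x \<in> T" for x
    proof -
      have "(\<Sum>w\<in>?W. h w * M x w) = (\<Sum>w\<in>?W. a w * M x w)"
        by (intro sum.cong) (auto simp: h_def)
      then show ?thesis using M[of h x] a(3) that by (simp add: h_def)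
    qed
    have "h w\<^sub>0 = h \<rho>"
    proof (rule connected_const[OF assms(3), of h])
      fix b c assume "{b, c} \<in> T"
      moreover obtain x where x: "x = {b, c}" by simp
      ultimately have "x \<in> T" "{src x, tgt x} = {b, c}" using T[of x] by auto
      then show "h b = h c" using h[of x] by (auto simp: doubleton_eq_iff)
    next
      show "w\<^sub>0 \<in> V" "\<rho> \<in> V" using a(1) \<rho> by auto
    qed
    then show False using a(1,2) by (auto simp: h_def)
  qed
  ultimately show ?thesis using card.remove[OF assms(1) \<rho>] by simp
qed

lemma sum_vdeg:
  assumes "finite_simple_graph V E"
  shows "(\<Sum>u\<in>V. vdeg E u) = 2 * card E"
proof -
  have fin: "finite V" "finite E"
    using assms finite_subset[of E "Pow V"] by (auto simp: finite_simple_graph_def)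
  have "vdeg E u = (\<Sum>x\<in>E. of_bool (u \<in> x))" for u
    using fin(2) sum.inter_filter[of E "\<lambda>_. 1::nat" "\<lambda>x. u \<in> x"]
    by (simp add: vdeg_def of_bool_def)
  then have "(\<Sum>u\<in>V. vdeg E u) = (\<Sum>u\<in>V. \<Sum>x\<in>E. of_bool (u \<in> x))" by simp
  also have "\<dots> = (\<Sum>x\<in>E. \<Sum>u\<in>V. of_bool (u \<in> x))" by (rule sum.swap)
  also have "\<dots> = (\<Sum>x\<in>E. 2)"
  proof (intro sum.cong refl)
    fix x assume "x \<in> E"
    then have "{u \<in> V. u \<in> x} = x" "card x = 2" using assms by (auto simp: finite_simple_graph_def)
    then show "(\<Sum>u\<in>V. of_bool (u \<in> x)) = (2::nat)"
      using fin(1) sum.inter_filter[of V "\<lambda>_. 1::nat" "\<lambda>u. u \<in> x"] by (simp add: of_bool_def)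
  qed
  finally show ?thesis by simp
qed

section \<open>The symmetric tube as a graph\<close>

text \<open>
  A cochain on the quotient is an exchange-invariant function on the cells of the tube.
\<close>

lemma invariant_descends:
  fixes F :: "'v tube_cell \<Rightarrow> int"
  assumes "\<And>c. c \<in> tube_cells V E k \<Longrightarrow> F (exchange c) = F c"
  shows "\<exists>g\<in>carrier (cochains V E k). \<forall>c\<in>tube_cells V E k. g (z2_orbit c) = F c"
proof (intro bexI ballI)
  let ?g = "\<lambda>q\<in>sym_cells V E k. F (SOME c. c \<in> q)"
  show "?g \<in> carrier (cochains V E k)" by (simp add: cochains_def)
  fix c assume c: "c \<in> tube_cells V E k"
  have "(SOME c'. c' \<in> z2_orbit c) \<in> z2_orbit c"
    by (rule someI[of _ c]) (simp add: z2_orbit_def)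
  then have "F (SOME c'. c' \<in> z2_orbit c) = F c"
    using assms[OF c] by (auto simp: z2_orbit_def)
  then show "?g (z2_orbit c) = F c" using c by (simp add: sym_cells_def)
qed

text \<open>
  The numbering of vertices and edges enters the choice of the basis only through the order that
  it induces on the neighbours of each vertex. Here \<open>r u a\<close> stands for the position of \<open>a\<close> in this
  order at \<open>u\<close>.
\<close>

locale ranked_graph =
  fixes V :: "'v set" and E T :: "'v set set" and src tgt :: "'v set \<Rightarrow> 'v"
    and r :: "'v \<Rightarrow> 'v \<Rightarrow> nat"
  assumes simple: "finite_simple_graph V E"
    and orient: "orientation E src tgt"
    and tree: "spanning_tree V E T"
    and rank_inj: "\<And>u. u \<in> V \<Longrightarrow> inj_on (r u) {a. {u, a} \<in> E}"
begin

definition top_nb :: "'v \<Rightarrow> 'v \<Rightarrow> bool" where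
  "top_nb u a \<longleftrightarrow> {u, a} \<in> E \<and> (\<forall>b. {u, b} \<in> E \<longrightarrow> r u b \<le> r u a)"

text \<open>
  The 0-cells: \<open>P0 u a b\<close> is the cell $Z$ of the edge $(u,b)$ at \<open>u\<close> if \<open>a = u\<close> (and likewise with
  \<open>a\<close> and \<open>b\<close> exchanged), and the cell $W$ of \<open>a, b\<close> at \<open>u\<close> otherwise. The 1-cells \<open>X1 x\<close> and
  \<open>Y1 u a b\<close> are the cells $X$ and $Y$; the latter leads from the 0-cell of \<open>a\<close> at \<open>u\<close> to that
  of \<open>a, b\<close>.
\<close>

abbreviation P0 :: "'v \<Rightarrow> 'v \<Rightarrow> 'v \<Rightarrow> 'v tube_cell set" where
  "P0 u a b \<equiv> sym_cell {u} {a} {b}"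

abbreviation X1 :: "'v set \<Rightarrow> 'v tube_cell set" where
  "X1 x \<equiv> sym_cell x {src x} {tgt x}"

abbreviation Y1 :: "'v \<Rightarrow> 'v \<Rightarrow> 'v \<Rightarrow> 'v tube_cell set" where
  "Y1 u a b \<equiv> sym_cell {u} {a} {u, b}"

text \<open>
  The complement of a spanning tree of the symmetric tube. The half edge that starts at the
  lower-ranked of two neighbours is deleted, unless the other neighbour is the top one: the star
  at the top neighbour stays.
\<close>

definition basis_cells :: "'v tube_cell set set" where
  "basis_cells = X1 ` (E - T) \<union>
     {Y1 u a b |u a b. {u, a} \<in> E \<and> {u, b} \<in> E \<and> r u a < r u b \<and> \<not> top_nb u b}"

abbreviation \<delta> where "\<delta> \<equiv> coboundary V E src tgt 0"

lemma finite_V: "finite V" and finite_E: "finite E"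
  using simple finite_subset[of E "Pow V"] by (auto simp: finite_simple_graph_def)

lemma T_sub: "T \<subseteq> E" using tree by (simp add: spanning_tree_def)

lemma edge_ends:
  assumes "x \<in> E"
  shows "x = {src x, tgt x}" "src x \<noteq> tgt x" "src x \<in> V" "tgt x \<in> V" "card x = 2" "x \<subseteq> V"
proof -
  show 1: "x = {src x, tgt x}" using assms orient by (auto simp: orientation_def)
  show 2: "card x = 2" "x \<subseteq> V" using assms simple by (auto simp: finite_simple_graph_def)
  show "src x \<in> V" "tgt x \<in> V" using 1 2(2) by auto
  have "card {src x, tgt x} = 2" using 1 2(1) by simp
  then show "src x \<noteq> tgt x" by auto
qed

lemma mem_edge: "x \<in> E \<Longrightarrow> a \<in> x \<longleftrightarrow> a = src x \<or> a = tgt x"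
  using arg_cong[OF edge_ends(1), of x "\<lambda>y. a \<in> y"] by simp

lemma edge_pair:
  assumes "{a, b} \<in> E"
  shows "a \<noteq> b" "b \<noteq> a" "a \<in> V" "b \<in> V" "{b, a} \<in> E"
    "src {a, b} = a \<and> tgt {a, b} = b \<or> src {a, b} = b \<and> tgt {a, b} = a"
proof -
  obtain x where x: "x = {a, b}" by simp
  then have "{src x, tgt x} = {a, b}" "src x \<noteq> tgt x" "src x \<in> V" "tgt x \<in> V"
    using edge_ends[of x] assms by auto
  then have "a \<noteq> b \<and> a \<in> V \<and> b \<in> V \<and> (src x = a \<and> tgt x = b \<or> src x = b \<and> tgt x = a)"
    by (auto simp: doubleton_eq_iff)
  then show "a \<noteq> b" "b \<noteq> a" "a \<in> V" "b \<in> V"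
    "src {a, b} = a \<and> tgt {a, b} = b \<or> src {a, b} = b \<and> tgt {a, b} = a"
    unfolding x by blast+
  show "{b, a} \<in> E" using assms by (simp add: insert_commute)
qed

lemma simplex_cases:
  assumes "s \<in> simplices V E"
  obtains u where "u \<in> V" "s = {u}" | "s \<in> E"
  using assms by (auto simp: simplices_def)

text \<open>
  An edge is a maximal simplex, so a simplex that contains it together with \<open>u\<close> is the edge itself.
\<close>

lemma simplex_inside_vertex_or_edge:
  assumes "{u} \<union> s \<subseteq> x" "x \<in> simplices V E" "s \<in> E"
  shows "u \<in> s"
proof -
  have "card s = 2" using edge_ends[OF assms(3)] by simp
  moreover have "card x \<le> 2" "finite x"
    using assms(2) edge_ends(5)[of x] by (auto elim!: simplex_cases intro: card_ge_0_finite)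
  ultimately have "s = x" using assms(1) by (intro card_seteq) auto
  then show ?thesis using assms(1) by simp
qed

lemma zero_cells:
  "({u}, {a}, {b}) \<in> tube_cells V E 0 \<longleftrightarrow>
     u \<in> V \<and> a \<noteq> b \<and> (a = u \<or> {u, a} \<in> E) \<and> (b = u \<or> {u, b} \<in> E)"
proof -
  have pair: "(\<exists>x\<in>simplices V E. {u, a} \<subseteq> x) \<longleftrightarrow> a = u \<or> {u, a} \<in> E" if "u \<in> V" for a
  proof
    assume "\<exists>x\<in>simplices V E. {u, a} \<subseteq> x"
    then obtain x where x: "x \<in> simplices V E" "{u, a} \<subseteq> x" by auto
    from x(1) show "a = u \<or> {u, a} \<in> E"
    proof (cases rule: simplex_cases)
      case 2
      have "{u, a} = x" if "a \<noteq> u"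
        using x(2) edge_ends(1,5)[OF 2] that by (intro card_seteq) (auto intro: card_ge_0_finite)
      then show ?thesis using 2 by auto
    qed (use x in auto)
  qed (use that in \<open>auto simp: simplices_def\<close>)
  have V: "{w} \<in> simplices V E \<longleftrightarrow> w \<in> V" for w
    using edge_ends(5)[of "{w}"] by (auto simp: simplices_def)
  show ?thesis
    using pair[of a] pair[of b] edge_pair(4)[of u]
    by (auto simp: tube_cells_def tube_def simplex_dim_def V)
qed

lemma zero_cell_cases:
  assumes "c \<in> tube_cells V E 0"
  obtains u a b where "c = ({u}, {a}, {b})"
proof -
  obtain s s1 s2 where c: "c = (s, s1, s2)" by (cases c) auto
  have "\<exists>u. t = {u}" if "t \<in> simplices V E" "simplex_dim t = 0" for t
    using that edge_ends(5)[of t] by (auto simp: simplex_dim_def elim!: simplex_cases)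
  then have "(\<exists>u. s = {u}) \<and> (\<exists>a. s1 = {a}) \<and> (\<exists>b. s2 = {b})"
    using assms by (simp add: c tube_cells_def tube_def)
  then show ?thesis using that c by blast
qed

lemma one_cells_X: "x \<in> E \<Longrightarrow> (x, {src x}, {tgt x}) \<in> tube_cells V E 1"
  using edge_ends[of x]
  by (auto simp: tube_cells_def tube_def simplex_dim_def simplices_def intro!: bexI[of _ x])

lemma one_cells_Y:
  assumes "{u, a} \<in> E" "{u, b} \<in> E" "a \<noteq> b"
  shows "({u}, {a}, {u, b}) \<in> tube_cells V E 1"
  using assms edge_pair[OF assms(1)] edge_pair[OF assms(2)]
  by (auto simp: tube_cells_def tube_def simplex_dim_def simplices_def)

lemma one_cell_cases:
  assumes "c \<in> tube_cells V E 1"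
  obtains x where "x \<in> E" "z2_orbit c = X1 x"
  | u a b where "{u, a} \<in> E" "{u, b} \<in> E" "a \<noteq> b" "z2_orbit c = Y1 u a b"
proof -
  obtain s s1 s2 where c: "c = (s, s1, s2)" by (cases c) auto
  have sim: "s \<in> simplices V E" "s1 \<in> simplices V E" "s2 \<in> simplices V E"
    and disj: "s1 \<inter> s2 = {}"
    and sub: "\<exists>x\<in>simplices V E. s \<union> s1 \<subseteq> x" "\<exists>x\<in>simplices V E. s \<union> s2 \<subseteq> x"
    and dim: "simplex_dim s + simplex_dim s1 + simplex_dim s2 = 1"
    using assms by (auto simp: c tube_cells_def tube_def)
  have dimE: "simplex_dim t = 1" if "t \<in> E" for t
    using edge_ends(5)[OF that] by (simp add: simplex_dim_def)
  have dimV: "simplex_dim {u} = 0" for u :: 'v by (simp add: simplex_dim_def)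
  \<comment> \<open>If the base is a vertex \<open>u\<close>, then the edge factor \<open>t\<close> contains \<open>u\<close>, and the vertex factor
    is a further neighbour of \<open>u\<close>, as it lies outside \<open>t\<close>.\<close>
  have Y: "\<exists>b. {u, a} \<in> E \<and> {u, b} \<in> E \<and> a \<noteq> b \<and> t = {u, b}"
    if ua: "\<exists>x\<in>simplices V E. {u} \<union> {a} \<subseteq> x" and ut: "\<exists>x\<in>simplices V E. {u} \<union> t \<subseteq> x"
      and t: "t \<in> E" "a \<notin> t" and "u \<in> V" "a \<in> V" for u a t
  proof -
    have "u \<in> t" using simplex_inside_vertex_or_edge ut t(1) by blast
    then obtain b where b: "t = {u, b}" using edge_ends(1)[OF t(1)] mem_edge[OF t(1)]
      by (metis insert_commute)
    have "({u}, {u}, {a}) \<in> tube_cells V E 0"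
      using ua that \<open>u \<in> t\<close> by (auto simp: tube_cells_def tube_def simplices_def dimV)
    then have "{u, a} \<in> E" using zero_cells by blast
    then show ?thesis using b t by auto
  qed
  from sim(1) show thesis
  proof (cases rule: simplex_cases)
    case 2
    have "s1 \<notin> E" "s2 \<notin> E" using dim dimE[OF 2] dimE[of s1] dimE[of s2] by auto
    then have "\<exists>a. s1 = {a}" "\<exists>b. s2 = {b}" using sim(2,3) by (auto simp: simplices_def)
    then obtain a b where ab: "s1 = {a}" "s2 = {b}" "a \<noteq> b" using disj by blast
    have "a \<in> s" "b \<in> s"
      using sub simplex_inside_vertex_or_edge[of a s] simplex_inside_vertex_or_edge[of b s] 2 ab
      by (auto simp: Un_commute)
    then have "a = src s \<and> b = tgt s \<or> a = tgt s \<and> b = src s"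
      using mem_edge[OF 2] ab(3) by auto
    then have "z2_orbit c = X1 s"
      using ab by (auto simp: c z2_orbit_def)
    then show thesis using that(1)[OF 2] by blast
  next
    case (1 u)
    have "t \<in> E \<or> (\<exists>a\<in>V. t = {a})" if "t \<in> simplices V E" for t
      using that by (auto simp: simplices_def)
    then have "s1 \<in> E \<or> (\<exists>a\<in>V. s1 = {a})" "s2 \<in> E \<or> (\<exists>a\<in>V. s2 = {a})"
      using sim(2,3) by auto
    moreover have "\<not> (s1 \<in> E \<and> s2 \<in> E)" using dim dimE[of s1] dimE[of s2] by auto
    moreover have "\<not> ((\<exists>a\<in>V. s1 = {a}) \<and> (\<exists>a\<in>V. s2 = {a}))" using dim dimV 1 by auto
    ultimately obtain a t where at: "a \<in> V" "t \<in> E" "(s1, s2) = ({a}, t) \<or> (s1, s2) = (t, {a})" by auto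
    have at': "a \<notin> t \<and> (\<exists>x\<in>simplices V E. {u} \<union> {a} \<subseteq> x) \<and> (\<exists>x\<in>simplices V E. {u} \<union> t \<subseteq> x)"
      using at(3) disj sub unfolding 1(2) by (elim disjE) (simp_all add: conj_commute)
    obtain b where b: "{u, a} \<in> E" "{u, b} \<in> E" "a \<noteq> b" "t = {u, b}"
      using Y[of u a t] at' at(1,2) 1(1) by blast
    have "z2_orbit c = Y1 u a b"
      using at(3) b(4) 1 by (auto simp: c z2_orbit_def)
    then show thesis using that(2) b by blast
  qed
qed

lemma sym_cells_one:
  "sym_cells V E 1 = X1 ` E \<union> {Y1 u a b |u a b. {u, a} \<in> E \<and> {u, b} \<in> E \<and> a \<noteq> b}"
proof (intro equalityI subsetI)
  fix q assume "q \<in> sym_cells V E 1"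
  then obtain c where c: "c \<in> tube_cells V E 1" "q = z2_orbit c" by (auto simp: sym_cells_def)
  from c(1) show "q \<in> X1 ` E \<union> {Y1 u a b |u a b. {u, a} \<in> E \<and> {u, b} \<in> E \<and> a \<noteq> b}"
    by (cases rule: one_cell_cases) (unfold c(2), blast+)
next
  fix q assume "q \<in> X1 ` E \<union> {Y1 u a b |u a b. {u, a} \<in> E \<and> {u, b} \<in> E \<and> a \<noteq> b}"
  then show "q \<in> sym_cells V E 1"
    unfolding sym_cells_def using one_cells_X one_cells_Y by blast
qed

lemma sym_cells_two: "sym_cells V E (Suc 1) = {}"
  using tube_dim_le_1[OF simple] by (fastforce simp: sym_cells_def tube_cells_def)

lemma X1_eq_iff: "X1 x = X1 y \<longleftrightarrow> x = y"
  by (auto simp: z2_orbit_def doubleton_eq_iff)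

lemma Y1_eq_iff:
  assumes "u \<noteq> b" "u' \<noteq> b'"
  shows "Y1 u a b = Y1 u' a' b' \<longleftrightarrow> u = u' \<and> a = a' \<and> b = b'"
  using assms by (auto simp: z2_orbit_def doubleton_eq_iff)

lemma X1_neq_Y1: "x \<in> E \<Longrightarrow> X1 x \<noteq> Y1 u a b"
proof
  assume x: "x \<in> E" and "X1 x = Y1 u a b"
  then have "fst ` X1 x = fst ` Y1 u a b" by simp
  then have "x = {u}" by (simp add: z2_orbit_def)
  then show False using edge_ends(5)[OF x] by simp
qed

lemma finite_cells: "finite (tube_cells V E k)"
proof -
  have "finite (simplices V E)" using finite_V finite_E by (simp add: simplices_def Setcompr_eq_image)
  then have "finite (simplices V E \<times> simplices V E \<times> simplices V E)" by simp
  then show ?thesis by (rule rev_finite_subset) (auto simp: tube_cells_def tube_def)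
qed

lemma coboundary_X1:
  assumes x: "x \<in> E"
  shows "\<delta> g (X1 x) = g (P0 (tgt x) (src x) (tgt x)) - g (P0 (src x) (src x) (tgt x))"
proof -
  let ?c = "(x, {src x}, {tgt x})" and ?p = "({tgt x}, {src x}, {tgt x})" and ?q = "({src x}, {src x}, {tgt x})"
  note e = edge_ends[OF x]
  have "{src x, tgt x} \<in> E" "{tgt x, src x} \<in> E" using e(1) x by (simp_all add: insert_commute)
  then have sub: "{?p, ?q} \<subseteq> tube_cells V E 0" using e by (auto simp: zero_cells)
  have inc: "cell_inc src tgt ?c (t, t1, t2) =
      (of_bool (t = {tgt x}) - of_bool (t = {src x})) * of_bool (t1 = {src x} \<and> t2 = {tgt x})" for t t1 t2
    using e(5) by (auto simp: simplex_inc_def)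
  have "\<delta> g (X1 x) = (\<Sum>c'\<in>tube_cells V E 0. cell_inc src tgt ?c c' * g (z2_orbit c'))"
    using coboundary_orbit[OF simple, of ?c 0] one_cells_X[OF x] by (simp add: tube_coboundary_def)
  also have "\<dots> = (\<Sum>c'\<in>{?p, ?q}. cell_inc src tgt ?c c' * g (z2_orbit c'))"
    using sub by (intro sum.mono_neutral_right finite_cells)
      (auto simp: inc simp del: cell_inc.simps)
  also have "\<dots> = g (z2_orbit ?p) - g (z2_orbit ?q)"
    using e(2) by (simp add: inc del: cell_inc.simps)
  finally show ?thesis .
qed

definition orient_sign :: "'v \<Rightarrow> 'v \<Rightarrow> int" where
  "orient_sign u b = (if tgt {u, b} = b then 1 else -1)"

lemma coboundary_Y1:
  assumes uab: "{u, a} \<in> E" "{u, b} \<in> E" "a \<noteq> b"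
  shows "\<delta> g (Y1 u a b) = orient_sign u b * (g (P0 u a b) - g (P0 u a u))"
proof -
  let ?c = "({u}, {a}, {u, b})" and ?p = "({u}, {a}, {b})" and ?q = "({u}, {a}, {u})"
  note e = edge_pair[OF uab(1)] edge_pair[OF uab(2)]
  have sub: "{?p, ?q} \<subseteq> tube_cells V E 0" using e uab by (auto simp: zero_cells)
  have inc: "cell_inc src tgt ?c (t, t1, t2) =
      orient_sign u b * (of_bool (t2 = {b}) - of_bool (t2 = {u})) * of_bool (t = {u} \<and> t1 = {a})" for t t1 t2
    using e(7) edge_pair(6)[OF uab(2)]
    by (auto simp: simplex_inc_def simplex_dim_def orient_sign_def card_2_iff)
  have "\<delta> g (Y1 u a b) = (\<Sum>c'\<in>tube_cells V E 0. cell_inc src tgt ?c c' * g (z2_orbit c'))"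
    using coboundary_orbit[OF simple, of ?c 0] one_cells_Y[OF uab] by (simp add: tube_coboundary_def)
  also have "\<dots> = (\<Sum>c'\<in>{?p, ?q}. cell_inc src tgt ?c c' * g (z2_orbit c'))"
    using sub by (intro sum.mono_neutral_right finite_cells)
      (auto simp: inc simp del: cell_inc.simps)
  also have "\<dots> = orient_sign u b * (g (z2_orbit ?p) - g (z2_orbit ?q))"
    using e(7) by (simp add: inc algebra_simps del: cell_inc.simps)
  finally show ?thesis .
qed

lemma basis_cells_sub: "basis_cells \<subseteq> sym_cells V E 1"
  unfolding sym_cells_one basis_cells_def by auto

lemma X1_notin_basis: "x \<in> T \<Longrightarrow> X1 x \<notin> basis_cells"
  using X1_neq_Y1[of x] T_sub by (auto simp: basis_cells_def X1_eq_iff)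

lemma Y1_in_basis_iff:
  assumes "{u, a} \<in> E" "{u, b} \<in> E"
  shows "Y1 u a b \<in> basis_cells \<longleftrightarrow> r u a < r u b \<and> \<not> top_nb u b"
proof
  assume "Y1 u a b \<in> basis_cells"
  then obtain u' a' b' where "Y1 u a b = Y1 u' a' b'" "{u', b'} \<in> E" "r u' a' < r u' b' \<and> \<not> top_nb u' b'"
    using X1_neq_Y1 unfolding basis_cells_def by blast
  then show "r u a < r u b \<and> \<not> top_nb u b"
    using Y1_eq_iff[of u b u' b' a a'] edge_pair(1)[OF assms(2)] edge_pair(1) by blast
qed (use assms in \<open>auto simp: basis_cells_def\<close>)

lemma top_nb_exists:
  assumes "{u, a} \<in> E"
  shows "\<exists>b. top_nb u b"
proof -
  let ?N = "{a. {u, a} \<in> E}"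
  have "finite ?N" by (rule finite_subset[OF _ finite_V]) (auto dest: edge_pair)
  then have "Max (r u ` ?N) \<in> r u ` ?N" using assms by (intro Max_in) auto
  then obtain b where b: "Max (r u ` ?N) = r u b" "b \<in> ?N" by (rule imageE)
  have "r u c \<le> r u b" if "{u, c} \<in> E" for c
    unfolding b(1)[symmetric] using that \<open>finite ?N\<close> by (intro Max_ge) auto
  then have "top_nb u b" using b(2) by (auto simp: top_nb_def)
  then show ?thesis ..
qed

lemma top_nb_unique:
  assumes "top_nb u a" "top_nb u b"
  shows "a = b"
proof -
  have "{u, a} \<in> E" "{u, b} \<in> E" "r u a = r u b"
    using assms by (auto simp: top_nb_def intro: antisym)
  then show ?thesis using rank_inj[of u] edge_pair(3)[of u a] by (auto dest: inj_onD)
qed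

lemma P0_swap: "P0 u a b = P0 u b a"
  by (auto simp: z2_orbit_def)

text \<open>
  This expresses that the cells outside \<open>basis_cells\<close> connect all 0-cells: a function whose
  coboundary vanishes on them is constant.
\<close>

lemma coboundary_zero_if_zero_off_basis:
  assumes off: "\<And>q. q \<in> sym_cells V E 1 - basis_cells \<Longrightarrow> \<delta> g q = 0"
    and q: "q \<in> sym_cells V E 1"
  shows "\<delta> g q = 0"
proof -
  have offX: "\<delta> g (X1 x) = 0" if "x \<in> T" for x
    using off[of "X1 x"] X1_notin_basis[OF that] that T_sub
    unfolding sym_cells_one by blast
  have offY: "g (P0 u a b) = g (P0 u a u)"
    if "{u, a} \<in> E" "{u, b} \<in> E" "a \<noteq> b" "r u b \<le> r u a \<or> top_nb u b" for u a b
  proof -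
    have "Y1 u a b \<notin> basis_cells" using Y1_in_basis_iff that by auto
    then have "\<delta> g (Y1 u a b) = 0" using off that unfolding sym_cells_one by blast
    then show ?thesis using coboundary_Y1[OF that(1-3)] by (simp add: orient_sign_def split: if_splits)
  qed
  \<comment> \<open>Around \<open>u\<close>, the edges towards the top neighbour form a star that reaches all points.\<close>
  have Z: "g (P0 u a u) = g (P0 u b u)" if ab: "{u, a} \<in> E" "{u, b} \<in> E" for u a b
  proof -
    obtain t where t: "top_nb u t" using top_nb_exists[OF ab(1)] by blast
    then have tE: "{u, t} \<in> E" by (simp add: top_nb_def)
    have "g (P0 u a u) = g (P0 u t u)" if a: "{u, a} \<in> E" for a
    proof (cases "a = t")
      case False
      have "g (P0 u a t) = g (P0 u a u)" using offY a tE False t by auto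
      moreover have "g (P0 u t a) = g (P0 u t u)"
        using offY[OF tE a] t a False by (auto simp: top_nb_def)
      ultimately show ?thesis by (simp add: P0_swap)
    qed simp
    then show ?thesis using ab by metis
  qed
  have W: "g (P0 u a b) = g (P0 u a u)" if ab: "{u, a} \<in> E" "{u, b} \<in> E" "a \<noteq> b" for u a b
  proof (cases "r u b \<le> r u a")
    case True
    then show ?thesis using offY ab by blast
  next
    case False
    then have "g (P0 u b a) = g (P0 u b u)" using offY ab by auto
    then show ?thesis using Z[OF ab(1,2)] by (simp add: P0_swap)
  qed
  \<comment> \<open>So \<open>g\<close> depends only on the base point, and the tree edges join all base points.\<close>
  define h where "h u = g (P0 u (SOME a. {u, a} \<in> E) u)" for u
  have h: "g (P0 u a u) = h u" if "{u, a} \<in> E" for u a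
    unfolding h_def using Z[OF that] someI[of "\<lambda>a. {u, a} \<in> E", OF that] by blast
  have T_const: "h a = h b" if "{a, b} \<in> T" for a b
  proof -
    have E: "{a, b} \<in> E" using that T_sub by auto
    then have "g (P0 a b a) = g (P0 b a b)"
      using offX[OF that] coboundary_X1[OF E] edge_pair(6)[OF E] by (auto simp: P0_swap)
    then show ?thesis using h[OF E] h[of b a] E by (simp add: insert_commute)
  qed
  have "connected_graph V T" using tree by (simp add: spanning_tree_def)
  then have const: "h u = h w" if "u \<in> V" "w \<in> V" for u w
    using that T_const connected_const[of V T h u w] by blast
  from q consider x where "x \<in> E" "q = X1 x"
    | u a b where "{u, a} \<in> E" "{u, b} \<in> E" "a \<noteq> b" "q = Y1 u a b"
    unfolding sym_cells_one by auto
  then show ?thesis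
  proof cases
    case 1
    have "{src x, tgt x} \<in> E" "{tgt x, src x} \<in> E"
      using edge_ends(1)[OF 1(1)] 1(1) by (simp_all add: insert_commute)
    then show ?thesis
      using h[of "tgt x" "src x"] h[of "src x" "tgt x"] const[of "src x" "tgt x"] edge_ends[OF 1(1)]
      by (simp add: 1 coboundary_X1 P0_swap)
  next
    case 2
    then show ?thesis using coboundary_Y1[OF 2(1-3)] W by simp
  qed
qed

text \<open>
  This expresses that the cells outside \<open>basis_cells\<close> contain no cycle. The required function is
  built piece by piece: around each vertex \<open>u\<close> it is determined along the star, up to the value
  \<open>h u\<close> at the top neighbour. The cells over the tree edges then prescribe the differences of \<open>h\<close>
  along the spanning tree \<open>T\<close>, so that a potential on \<open>T\<close> supplies \<open>h\<close>.
\<close>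

lemma coboundary_prescribed_off_basis:
  "\<exists>g\<in>carrier (cochains V E 0). \<forall>q\<in>sym_cells V E 1 - basis_cells. \<delta> g q = f q"
proof -
  \<comment> \<open>\<open>D u a b\<close> is the required increase from \<open>P0 u a u\<close> to \<open>P0 u a b\<close>.\<close>
  define D where "D u a b = orient_sign u b * f (Y1 u a b)" for u a b
  define t where "t u = (SOME t. top_nb u t)" for u
  have t: "top_nb u (t u)" if "{u, a} \<in> E" for u a
    unfolding t_def using top_nb_exists[OF that] by (rule someI_ex)
  \<comment> \<open>The value at \<open>P0 u a u\<close> relative to \<open>P0 u (t u) u\<close>, read off the path through \<open>P0 u a (t u)\<close>.\<close>
  define p where "p u a = (if a = t u then 0 else D u (t u) a - D u a (t u))" for u a
  obtain h where h: "\<And>x. x \<in> T \<Longrightarrow>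
      h (tgt x) - h (src x) = f (X1 x) - p (tgt x) (src x) + p (src x) (tgt x)"
  proof -
    have T: "finite T" "\<nexists>p. graph_cycle T p"
      using tree finite_subset[OF T_sub finite_E] by (auto simp: spanning_tree_def)
    have ends: "x = {src x, tgt x} \<and> src x \<noteq> tgt x" if "x \<in> T" for x
      using edge_ends(1,2)[of x] T_sub that by blast
    show thesis
      using acyclic_potential[OF T ends, of "\<lambda>x. f (X1 x) - p (tgt x) (src x) + p (src x) (tgt x)"]
        that by blast
  qed
  define F where "F u a b = (if a = u then h u + p u b else if b = u then h u + p u a
     else if r u b < r u a then h u + p u a + D u a b else h u + p u b + D u b a)" for u a b
  have F_swap: "F u a b = F u b a" if "({u}, {a}, {b}) \<in> tube_cells V E 0" for u a b
  proof -
    have "r u a \<noteq> r u b" if "a \<noteq> u" "b \<noteq> u"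
      using \<open>({u}, {a}, {b}) \<in> _\<close> that rank_inj[of u] by (auto simp: zero_cells inj_on_def)
    moreover have "a \<noteq> b" using that by (simp add: zero_cells)
    ultimately show ?thesis by (auto simp: F_def)
  qed
  define F' where "F' c = (case c of (s, a, b) \<Rightarrow> F (the_elem s) (the_elem a) (the_elem b))" for c
  have "F' (exchange c) = F' c" if "c \<in> tube_cells V E 0" for c
  proof -
    from that obtain u a b where "c = ({u}, {a}, {b})" by (rule zero_cell_cases)
    then show ?thesis using F_swap[of u a b] that by (simp add: F'_def)
  qed
  then obtain g where g: "g \<in> carrier (cochains V E 0)"
      "\<And>c. c \<in> tube_cells V E 0 \<Longrightarrow> g (z2_orbit c) = F' c"
    using invariant_descends[of V E 0 F'] by blast
  have gF: "g (P0 u a b) = F u a b" if "({u}, {a}, {b}) \<in> tube_cells V E 0" for u a b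
    using g(2)[OF that] by (simp add: F'_def)
  have "\<delta> g q = f q" if q: "q \<in> sym_cells V E 1 - basis_cells" for q
  proof -
    from q consider x where "x \<in> E" "q = X1 x"
      | u a b where "{u, a} \<in> E" "{u, b} \<in> E" "a \<noteq> b" "q = Y1 u a b"
      unfolding sym_cells_one by auto
    then show ?thesis
    proof cases
      case 1
      note e = edge_ends[OF 1(1)]
      have "{src x, tgt x} \<in> E" "{tgt x, src x} \<in> E"
        using e(1) 1(1) by (simp_all add: insert_commute)
      then have "({tgt x}, {src x}, {tgt x}) \<in> tube_cells V E 0"
        "({src x}, {src x}, {tgt x}) \<in> tube_cells V E 0"
        using e by (auto simp: zero_cells)
      moreover have "x \<in> T" using q 1 by (auto simp: basis_cells_def)
      ultimately show ?thesis
        using h[of x] e(2) by (simp add: 1 coboundary_X1 gF F_def)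
    next
      case 2
      note e = edge_pair[OF 2(1)] edge_pair[OF 2(2)]
      have cells: "({u}, {a}, {b}) \<in> tube_cells V E 0" "({u}, {a}, {u}) \<in> tube_cells V E 0"
        using 2 e by (auto simp: zero_cells)
      have "r u b \<le> r u a \<or> top_nb u b"
        using q Y1_in_basis_iff[OF 2(1,2)] 2(4) by auto
      moreover have "r u a \<noteq> r u b"
        using rank_inj[of u] e 2 by (auto simp: inj_on_def)
      moreover have "top_nb u b \<Longrightarrow> r u a \<le> r u b" using 2 by (simp add: top_nb_def)
      moreover have "top_nb u b \<Longrightarrow> b = t u" using t[OF 2(1)] top_nb_unique by blast
      ultimately have "F u a b - F u a u = D u a b"
        using 2(3) e by (auto simp: F_def p_def)
      then show ?thesis
        using coboundary_Y1[OF 2(1-3)] by (simp add: 2 gF[OF cells(1)] gF[OF cells(2)] D_def orient_sign_def)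
    qed
  qed
  then show ?thesis using g(1) by blast
qed

end

section \<open>The first cohomology group\<close>

lemma comm_group_cochains: "comm_group (cochains V E k)"
proof (rule group.group_comm_groupI)
  show "Group.group (cochains V E k)" by (simp add: cochains_def)
qed (auto simp: cochains_def add.commute)

lemma group_cochains [simp]: "Group.group (cochains V E k)"
  using comm_group_cochains[of V E k] by (simp add: comm_group_def)

lemma cochain_int_pow:
  assumes "f \<in> carrier (cochains V E k)" "q \<in> sym_cells V E k"
  shows "(f [^]\<^bsub>cochains V E k\<^esub> (n::int)) q = n * f q"
proof -
  have "(\<lambda>f. f q) \<in> hom (cochains V E k) integer_group"
    using assms(2) by (auto simp: hom_def cochains_def)
  from hom_int_pow[OF this assms(1), of n] show ?thesis
    by simp
qed

lemma cochain_int_pow_closed: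
  "f \<in> carrier (cochains V E k) \<Longrightarrow> f [^]\<^bsub>cochains V E k\<^esub> (n::int) \<in> carrier (cochains V E k)"
  by (simp add: group.int_pow_closed)

context ranked_graph
begin

(* Degree 1 stays in this form, in which the abbreviations below match. *)
declare One_nat_def [simp del]

abbreviation C\<^sub>1 where "C\<^sub>1 \<equiv> cochains V E 1"
abbreviation B\<^sub>1 where "B\<^sub>1 \<equiv> coboundaries V E src tgt 1"
abbreviation H\<^sub>1 where "H\<^sub>1 \<equiv> cohomology V E src tgt 1"
abbreviation cls where "cls \<equiv> cohomology_class V E src tgt 1"

lemma carrier_C1: "carrier C\<^sub>1 = extensional (sym_cells V E 1)"
  by (auto simp: cochains_def PiE_def)

text \<open>
  There are no 2-cells, so that every 1-cochain is a cocycle.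
\<close>

lemma cocycle_group_one: "cocycle_group V E src tgt 1 = C\<^sub>1"
proof -
  have "kernel C\<^sub>1 (cochains V E (Suc 1)) (coboundary V E src tgt 1) = carrier C\<^sub>1"
    unfolding kernel_def coboundary_def sym_cells_two by (simp add: One_nat_def cochains_def sym_cells_two[unfolded One_nat_def] restrict_def)
  then show ?thesis
    by (simp add: cocycle_group_def group.subgroup_generated_group_carrier)
qed

lemma coboundaries_one: "B\<^sub>1 = \<delta> ` carrier (cochains V E 0)"
  by (simp add: One_nat_def coboundaries_def)

lemma coboundary_hom: "\<delta> \<in> hom (cochains V E 0) C\<^sub>1"
proof (rule homI)
  fix f g assume fg: "f \<in> carrier (cochains V E 0)" "g \<in> carrier (cochains V E 0)"
  show "\<delta> (f \<otimes>\<^bsub>cochains V E 0\<^esub> g) = \<delta> f \<otimes>\<^bsub>C\<^sub>1\<^esub> \<delta> g"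
  proof -
    have "tube_coboundary V E src tgt 0 ((f \<otimes>\<^bsub>cochains V E 0\<^esub> g) \<circ> z2_orbit) c
        = tube_coboundary V E src tgt 0 (f \<circ> z2_orbit) c + tube_coboundary V E src tgt 0 (g \<circ> z2_orbit) c"
      for c
      unfolding tube_coboundary_def sum.distrib[symmetric]
      by (intro sum.cong) (auto simp: cochains_def sym_cells_def algebra_simps)
    then show ?thesis by (auto simp: One_nat_def coboundary_def cochains_def)
  qed
qed (simp add: One_nat_def coboundary_def cochains_def)

lemma subgroup_coboundaries: "subgroup B\<^sub>1 C\<^sub>1"
  unfolding coboundaries_one
  using coboundary_hom by (intro group_hom.img_is_subgroup) (simp add: group_hom_def group_hom_axioms_def)

lemma comm_group_H1: "comm_group H\<^sub>1"
  unfolding cohomology_def cocycle_group_one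
  by (rule comm_group.abelian_FactGroup[OF comm_group_cochains subgroup_coboundaries])

lemma cls_hom: "cls \<in> hom C\<^sub>1 H\<^sub>1"
proof -
  have "normal B\<^sub>1 C\<^sub>1"
    by (rule comm_group.subgroup_imp_normal[OF comm_group_cochains subgroup_coboundaries])
  then show ?thesis
    using normal.r_coset_hom_Mod[of B\<^sub>1 C\<^sub>1]
    by (simp add: cohomology_def cohomology_class_def[abs_def] cocycle_group_one)
qed

lemma carrier_H1: "carrier H\<^sub>1 = cls ` carrier C\<^sub>1"
  by (auto simp: cohomology_def cohomology_class_def carrier_FactGroup cocycle_group_one)

lemma cls_one_iff:
  assumes "f \<in> carrier C\<^sub>1"
  shows "cls f = \<one>\<^bsub>H\<^sub>1\<^esub> \<longleftrightarrow> f \<in> B\<^sub>1"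
proof -
  show ?thesis
    using group.coset_join1[OF group_cochains _ assms subgroup_coboundaries]
      group.coset_join2[OF group_cochains assms subgroup_coboundaries]
    by (auto simp: cohomology_def cohomology_class_def cocycle_group_one)
qed

lemma dual_closed: "dual_cochain V E 1 p \<in> carrier C\<^sub>1"
  by (simp add: dual_cochain_def carrier_C1)

lemma lincomb_cls:
  assumes "finite I"
  shows "comm_group.lincomb H\<^sub>1 (\<lambda>i. cls (dual_cochain V E 1 (q i))) I c
    = cls (\<lambda>p\<in>sym_cells V E 1. \<Sum>i\<in>I. c i * of_bool (p = q i))"
proof -
  interpret H: comm_group H\<^sub>1 by (rule comm_group_H1)
  have G: "Group.group C\<^sub>1" "Group.group H\<^sub>1"
    using comm_group_H1 by (simp_all add: comm_group_def)
  have closed: "cls f \<in> carrier H\<^sub>1" if "f \<in> carrier C\<^sub>1" for f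
    using that by (simp add: carrier_H1)
  show ?thesis
    using assms unfolding H.lincomb_def
  proof (induction I rule: finite_induct)
    case empty
    have "(\<lambda>p\<in>sym_cells V E 1. 0) = \<one>\<^bsub>C\<^sub>1\<^esub>" by (simp add: cochains_def)
    moreover have "cls \<one>\<^bsub>C\<^sub>1\<^esub> = \<one>\<^bsub>H\<^sub>1\<^esub>" by (rule hom_one[OF cls_hom G])
    ultimately show ?case by simp
  next
    case (insert i I)
    let ?d = "dual_cochain V E 1 (q i)" and ?S = "\<lambda>I. \<lambda>p\<in>sym_cells V E 1. \<Sum>i\<in>I. c i * of_bool (p = q i)"
    have "?S (insert i I) = ?d [^]\<^bsub>C\<^sub>1\<^esub> c i \<otimes>\<^bsub>C\<^sub>1\<^esub> ?S I"
    proof (rule extensionalityI[of _ "sym_cells V E 1"])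
      show "?d [^]\<^bsub>C\<^sub>1\<^esub> c i \<otimes>\<^bsub>C\<^sub>1\<^esub> ?S I \<in> extensional (sym_cells V E 1)"
        by (simp add: cochains_def)
      fix p assume p: "p \<in> sym_cells V E 1"
      have "(?d [^]\<^bsub>C\<^sub>1\<^esub> c i \<otimes>\<^bsub>C\<^sub>1\<^esub> ?S I) p = (?d [^]\<^bsub>C\<^sub>1\<^esub> c i) p + ?S I p"
        using p unfolding cochains_def by simp
      then show "?S (insert i I) p = (?d [^]\<^bsub>C\<^sub>1\<^esub> c i \<otimes>\<^bsub>C\<^sub>1\<^esub> ?S I) p"
        using p insert.hyps cochain_int_pow[OF dual_closed p]
        by (simp add: dual_cochain_def)
    qed simp
    moreover have "?S I \<in> carrier C\<^sub>1" by (simp add: carrier_C1)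
    ultimately have "cls (?S (insert i I)) = cls (?d [^]\<^bsub>C\<^sub>1\<^esub> c i) \<otimes>\<^bsub>H\<^sub>1\<^esub> cls (?S I)"
      using hom_mult[OF cls_hom] cochain_int_pow_closed[OF dual_closed] by simp
    also have "cls (?d [^]\<^bsub>C\<^sub>1\<^esub> c i) = cls ?d [^]\<^bsub>H\<^sub>1\<^esub> c i"
      by (rule hom_int_pow[OF cls_hom dual_closed G])
    finally show ?case
      using insert closed[OF dual_closed] by (simp add: H.finprod_insert)
  qed
qed

text \<open>
  Off the basis cells every cochain agrees with a coboundary. So each class contains a cochain that
  is supported on the basis cells, and its values there are the coordinates of the class. Two such
  cochains in one class differ by a coboundary that vanishes off the basis cells, which is zero.
\<close>

lemma int_basis_cls:
  assumes q: "bij_betw q I basis_cells"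
  shows "comm_group.int_basis H\<^sub>1 (\<lambda>i. cls (dual_cochain V E 1 (q i))) I"
proof -
  interpret H: comm_group H\<^sub>1 by (rule comm_group_H1)
  have "finite (sym_cells V E 1)" by (simp add: sym_cells_def finite_cells)
  then have fin: "finite I" using q basis_cells_sub by (metis bij_betw_finite finite_subset)
  have inj: "inj_on q I" and im: "q ` I = basis_cells" using q by (auto simp: bij_betw_def)
  have q1: "q i \<in> sym_cells V E 1" if "i \<in> I" for i using im basis_cells_sub that by auto
  define S where "S c = (\<lambda>p\<in>sym_cells V E 1. \<Sum>i\<in>I. c i * of_bool (p = q i))" for c :: "'a \<Rightarrow> int"
  have S: "H.lincomb (\<lambda>i. cls (dual_cochain V E 1 (q i))) I c = cls (S c)" for c
    unfolding S_def by (rule lincomb_cls[OF fin])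
  have SC: "S c \<in> carrier C\<^sub>1" for c by (simp add: S_def carrier_C1)
  have S_on: "S c (q i) = c i" if "i \<in> I" for c i
  proof -
    have "S c (q i) = (\<Sum>j\<in>I. c j * of_bool (q i = q j))"
      using q1[OF that] by (simp add: S_def)
    also have "\<dots> = (\<Sum>j\<in>I. if i = j then c j else 0)"
      using inj that by (intro sum.cong) (auto simp: inj_on_def)
    finally show ?thesis using that fin by simp
  qed
  have S_off: "S c p = 0" if "p \<in> sym_cells V E 1 - basis_cells" for c p
  proof -
    have "S c p = (\<Sum>j\<in>I. c j * of_bool (p = q j))" using that by (simp add: S_def)
    also have "\<dots> = (\<Sum>j\<in>I. 0)" using that im by (intro sum.cong) auto
    finally show ?thesis by simp
  qed
  show ?thesis unfolding H.int_basis_def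
  proof (intro conjI ballI allI impI)
    show "finite I" by (rule fin)
    show "(\<lambda>i. cls (dual_cochain V E 1 (q i))) \<in> I \<rightarrow> carrier H\<^sub>1"
      using dual_closed by (simp add: carrier_H1)
  next
    fix x assume "x \<in> carrier H\<^sub>1"
    then obtain f where f: "f \<in> carrier C\<^sub>1" "x = cls f" by (auto simp: carrier_H1)
    obtain g where g: "g \<in> carrier (cochains V E 0)"
        "\<And>p. p \<in> sym_cells V E 1 - basis_cells \<Longrightarrow> \<delta> g p = f p"
      using coboundary_prescribed_off_basis[of f] by blast
    define c where "c i = f (q i) - \<delta> g (q i)" for i
    have \<delta>g: "\<delta> g \<in> carrier C\<^sub>1" "\<delta> g \<in> B\<^sub>1"
      using g(1) coboundary_hom by (auto simp: hom_def coboundaries_one)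
    have "f = S c \<otimes>\<^bsub>C\<^sub>1\<^esub> \<delta> g"
    proof (rule extensionalityI[of _ "sym_cells V E 1"])
      show "f \<in> extensional (sym_cells V E 1)" using f(1) by (simp only: carrier_C1)
      show "S c \<otimes>\<^bsub>C\<^sub>1\<^esub> \<delta> g \<in> extensional (sym_cells V E 1)" by (simp add: cochains_def)
      fix p assume p: "p \<in> sym_cells V E 1"
      have "(S c \<otimes>\<^bsub>C\<^sub>1\<^esub> \<delta> g) p = S c p + \<delta> g p" using p unfolding cochains_def by simp
      moreover have "S c p + \<delta> g p = f p"
      proof (cases "p \<in> basis_cells")
        case True
        then obtain i where "i \<in> I" "p = q i" using im by auto
        then show ?thesis using S_on by (simp add: c_def)
      next
        case False
        then show ?thesis using g(2) S_off p by simp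
      qed
      ultimately show "f p = (S c \<otimes>\<^bsub>C\<^sub>1\<^esub> \<delta> g) p" by simp
    qed
    then have "x = cls (S c) \<otimes>\<^bsub>H\<^sub>1\<^esub> cls (\<delta> g)"
      using f(2) hom_mult[OF cls_hom SC \<delta>g(1)] by simp
    also have "cls (\<delta> g) = \<one>\<^bsub>H\<^sub>1\<^esub>" using cls_one_iff \<delta>g by simp
    finally have "x = cls (S c)" using SC by (simp add: carrier_H1)
    then show "\<exists>c. x = H.lincomb (\<lambda>i. cls (dual_cochain V E 1 (q i))) I c"
      using S by metis
  next
    fix c i assume c: "H.lincomb (\<lambda>i. cls (dual_cochain V E 1 (q i))) I c = \<one>\<^bsub>H\<^sub>1\<^esub>" and i: "i \<in> I"
    then have "S c \<in> B\<^sub>1" using S cls_one_iff[OF SC] by simp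
    then obtain g where g: "S c = \<delta> g" by (auto simp: coboundaries_one)
    have "\<delta> g (q i) = 0"
      using coboundary_zero_if_zero_off_basis[of g "q i"] S_off[of _ c] g q1[OF i] by simp
    then show "c i = 0" using S_on[OF i, of c] g by simp
  qed
qed

end

section \<open>Counting\<close>

lemma card_ordered_pairs: "2 * card {(j, k). 1 \<le> j \<and> j < k \<and> k \<le> D} = D * (D - 1)" for D :: nat
proof (induction D)
  case 0
  have "{(j, k). 1 \<le> j \<and> j < k \<and> k \<le> (0::nat)} = {}" by auto
  then show ?case by (metis card.empty mult_0 mult_0_right)
next
  case (Suc D)
  have eq: "{(j, k). 1 \<le> j \<and> j < k \<and> k \<le> Suc D}
      = {(j, k). 1 \<le> j \<and> j < k \<and> k \<le> D} \<union> (\<lambda>j. (j, Suc D)) ` {1..D}"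
    by (auto simp: le_Suc_eq)
  have fin: "finite {(j, k). 1 \<le> j \<and> j < k \<and> k \<le> D}"
    by (rule finite_subset[of _ "{1..D} \<times> {1..D}"]) auto
  have "card {(j, k). 1 \<le> j \<and> j < k \<and> k \<le> Suc D}
      = card {(j, k). 1 \<le> j \<and> j < k \<and> k \<le> D} + card ((\<lambda>j. (j, Suc D)) ` {1..D})"
    unfolding eq by (rule card_Un_disjoint[OF fin]) auto
  also have "card ((\<lambda>j. (j, Suc D)) ` {1..D}) = D" by (simp add: card_image inj_on_def)
  finally show ?case using Suc.IH by (cases D) (auto simp: algebra_simps)
qed

text \<open>
  Isolated vertices have to be excluded from the count of the basis cells: there are none around an
  isolated vertex, while $(d-1)(d-2)/2$ is 1 for $d = 0$.
\<close>

lemma vdeg_pos: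
  assumes "connected_graph V E" "finite_simple_graph V E" "E \<noteq> {}" "u \<in> V"
  shows "vdeg E u \<ge> 1"
proof -
  have fin: "finite E"
    using assms(2) finite_subset[of E "Pow V"] by (auto simp: finite_simple_graph_def)
  obtain x where "x \<in> E" "x \<subseteq> V" "card x = 2" using assms(2,3) by (auto simp: finite_simple_graph_def)
  then obtain w where w: "w \<in> V" "w \<noteq> u" by (auto simp: card_2_iff)
  then have "(u, w) \<in> {(a, b). {a, b} \<in> E}\<^sup>*" using assms(1,4) by (auto simp: connected_graph_def)
  then obtain a where "{u, a} \<in> E" using w(2) by (auto elim: converse_rtranclE)
  then have "{x \<in> E. u \<in> x} \<noteq> {}" by auto
  then show ?thesis using fin by (simp add: vdeg_def card_gt_0_iff Suc_le_eq)
qed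

section \<open>The cohomology of the symmetric tube\<close>

theorem theorem3p10:
  fixes V :: "'v set" and E T :: "'v set set"
    and v :: "nat \<Rightarrow> 'v" and e :: "nat \<Rightarrow> 'v set" and m n :: nat
    and src tgt :: "'v set \<Rightarrow> 'v"
    and j1 j2 :: "nat \<Rightarrow> nat"
    and nb ie :: "nat \<Rightarrow> nat \<Rightarrow> nat"
  defines "d \<equiv> \<lambda>s. vdeg E (v s)"
    and "H1 \<equiv> cohomology V E src tgt 1"
    and "Xc \<equiv> \<lambda>j. sym_cell (e j) {v (j1 j)} {v (j2 j)}"
    and "Yc \<equiv> \<lambda>s (j, k). sym_cell {v s} {v (nb s j)} (e (ie s k))"
  defines "IX \<equiv> {j \<in> {1..n}. e j \<in> E - T}"
    and "IS \<equiv> {s \<in> {1..m}. d s \<ge> 3}"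
    and "IY \<equiv> \<lambda>s. {(j, k). 1 \<le> j \<and> j < k \<and> k \<le> d s - 1}"
  assumes "finite_simple_graph V E" and "connected_graph V E"
    and "bij_betw v {1..m} V" and "bij_betw e {1..n} E" and "n \<ge> 1"
    and "orientation E src tgt"
    and "spanning_tree V E T"
    and "\<And>j. j \<in> {1..n} \<Longrightarrow> j1 j \<in> {1..m} \<and> j2 j \<in> {1..m} \<and> e j = {v (j1 j), v (j2 j)}"
    and "\<And>s. s \<in> {1..m} \<Longrightarrow> bij_betw (nb s) {1..d s} {t \<in> {1..m}. {v s, v t} \<in> E}"
    and "\<And>s l. s \<in> {1..m} \<Longrightarrow> l \<in> {1..d s} \<Longrightarrow>
           ie s l \<in> {1..n} \<and> e (ie s l) = {v s, v (nb s l)}"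
    and "\<And>s. s \<in> {1..m} \<Longrightarrow> strict_mono_on {1..d s} (ie s)"
  shows "((\<forall>j\<in>IX. dual_class_group V E src tgt (Xc j) \<cong> integer_group) \<and>
          (\<forall>s\<in>IS. \<forall>p\<in>IY s. dual_class_group V E src tgt (Yc s p) \<cong> integer_group) \<and>
          (\<lambda>(x, y). finprod H1 x IX \<otimes>\<^bsub>H1\<^esub> finprod H1 (\<lambda>s. finprod H1 (y s) (IY s)) IS)
            \<in> iso (sum_group IX (\<lambda>j. dual_class_group V E src tgt (Xc j))
                   \<times>\<times> sum_group IS (\<lambda>s. sum_group (IY s)
                         (\<lambda>p. dual_class_group V E src tgt (Yc s p))))
                  H1)
         \<and> ereal_of_enat (abelian_rank H1)
             = ereal (1 - 2 * real n + 1 / 2 * (\<Sum>s = 1..m. (real (d s))\<^sup>2))"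
proof -
  have fsg: "finite_simple_graph V E" and conn: "connected_graph V E"
    and v: "bij_betw v {1..m} V" and e: "bij_betw e {1..n} E" and n: "n \<ge> 1"
    and orient: "orientation E src tgt" and T: "spanning_tree V E T"
    by (rule assms)+
  have ends: "j1 j \<in> {1..m}" "j2 j \<in> {1..m}" "e j = {v (j1 j), v (j2 j)}" if "j \<in> {1..n}" for j
    using assms(15)[OF that] by auto
  have ie: "ie s l \<in> {1..n}" "e (ie s l) = {v s, v (nb s l)}" if "s \<in> {1..m}" "l \<in> {1..d s}" for s l
    using assms(17)[OF that] by auto
  have v_inj: "inj_on v {1..m}" and v_im: "v ` {1..m} = V" using v by (auto simp: bij_betw_def)
  have e_inj: "inj_on e {1..n}" and e_im: "e ` {1..n} = E" using e by (auto simp: bij_betw_def)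
  have E_V: "a \<in> V" if "{u, a} \<in> E" for u a using that fsg by (auto simp: finite_simple_graph_def)

  define w where "w s l = v (nb s l)" for s l
  have w: "bij_betw (w s) {1..d s} {a. {v s, a} \<in> E}" if s: "s \<in> {1..m}" for s
  proof -
    have "bij_betw v {t \<in> {1..m}. {v s, v t} \<in> E} {a. {v s, a} \<in> E}"
    proof (rule bij_betw_imageI)
      show "inj_on v {t \<in> {1..m}. {v s, v t} \<in> E}" by (rule inj_on_subset[OF v_inj]) auto
      have "a \<in> v ` {1..m}" if "{v s, a} \<in> E" for a using E_V[OF that] v_im by simp
      then show "v ` {t \<in> {1..m}. {v s, v t} \<in> E} = {a. {v s, a} \<in> E}" by blast
    qed
    with assms(16)[OF s] have "bij_betw (v \<circ> nb s) {1..d s} {a. {v s, a} \<in> E}"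
      by (rule bij_betw_trans)
    then show ?thesis by (simp add: w_def[abs_def] comp_def)
  qed
  have w_inj: "inj_on (w s) {1..d s}" and w_im: "w s ` {1..d s} = {a. {v s, a} \<in> E}"
    if "s \<in> {1..m}" for s
    using w[OF that] by (auto simp: bij_betw_def)

  \<comment> \<open>The rank of a neighbour is its position in the given enumeration.\<close>
  define r where "r u a = inv_into {1..d (inv_into {1..m} v u)} (w (inv_into {1..m} v u)) a" for u a
  have r: "r (v s) (w s l) = l" if "s \<in> {1..m}" "l \<in> {1..d s}" for s l
    using that w_inj v_inj by (simp add: r_def)
  have nb_obtain: "\<exists>l\<in>{1..d s}. a = w s l" if "s \<in> {1..m}" "{v s, a} \<in> E" for s a
  proof -
    have "a \<in> w s ` {1..d s}" using w_im[OF that(1)] that(2) by simp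
    then show ?thesis by blast
  qed
  have w_edge: "{v s, w s l} \<in> E" if "s \<in> {1..m}" "l \<in> {1..d s}" for s l
    using w_im[OF that(1)] that(2) by blast
  interpret ranked_graph V E T src tgt r
  proof
    fix u assume "u \<in> V"
    then obtain s where s: "s \<in> {1..m}" "u = v s" using v_im by blast
    show "inj_on (r u) {a. {u, a} \<in> E}"
    proof (rule inj_onI)
      fix a b assume ab: "a \<in> {a. {u, a} \<in> E}" "b \<in> {a. {u, a} \<in> E}" "r u a = r u b"
      obtain k l where "k \<in> {1..d s}" "l \<in> {1..d s}" "a = w s k" "b = w s l"
        using nb_obtain[OF s(1)] ab(1,2) unfolding s(2) by blast
      then show "a = b" using r[OF s(1)] ab(3) s(2) by simp
    qed
  qed (use fsg orient T in auto)
  have top: "top_nb (v s) (w s l) \<longleftrightarrow> l = d s" if s: "s \<in> {1..m}" and l: "l \<in> {1..d s}" for s l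
  proof
    assume "top_nb (v s) (w s l)"
    moreover have "d s \<in> {1..d s}" using l by auto
    ultimately have "d s \<le> l" using w_edge[OF s] r[OF s] l by (metis top_nb_def)
    then show "l = d s" using l by auto
  next
    assume "l = d s"
    then show "top_nb (v s) (w s l)"
      unfolding top_nb_def using w_edge[OF s l] nb_obtain[OF s] r[OF s] l
      by (metis atLeastAtMost_iff)
  qed

  have Xc: "Xc j = X1 (e j)" if j: "j \<in> {1..n}" for j
  proof -
    have "e j \<in> E" using e_im j by auto
    then have "v (j1 j) \<in> e j" "v (j2 j) \<in> e j" "v (j1 j) \<noteq> v (j2 j)"
      using ends[OF j] edge_pair(1) by auto
    then have "v (j1 j) = src (e j) \<and> v (j2 j) = tgt (e j) \<or> v (j1 j) = tgt (e j) \<and> v (j2 j) = src (e j)"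
      using mem_edge[OF \<open>e j \<in> E\<close>] by auto
    then show ?thesis unfolding Xc_def z2_orbit_def by auto
  qed
  have Yc: "Yc s (j, k) = Y1 (v s) (w s j) (w s k)" if "s \<in> {1..m}" "k \<in> {1..d s}" for s j k
    unfolding Yc_def using ie(2)[OF that] by (simp add: w_def)
  have IY: "j \<in> {1..d s}" "k \<in> {1..d s}" "j < k" "k \<noteq> d s" if "(j, k) \<in> IY s" for s j k
    using that by (auto simp: IY_def)
  define I where "I = IX <+> Sigma IS IY"
  define q where "q = case_sum Xc (\<lambda>(s, p). Yc s p)"
  have IS: "s \<in> {1..m}" if "s \<in> IS" for s using that by (simp add: IS_def)
  have q_im: "q ` I = basis_cells"
  proof (intro equalityI subsetI)
    fix c assume "c \<in> q ` I"
    then consider j where "j \<in> IX" "c = Xc j" | s j k where "s \<in> IS" "(j, k) \<in> IY s" "c = Yc s (j, k)"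
      by (auto simp: I_def q_def)
    then show "c \<in> basis_cells"
    proof cases
      case 1
      then show ?thesis using Xc by (auto simp: IX_def basis_cells_def)
    next
      case 2
      note s = IS[OF 2(1)] and jk = IY[OF 2(2)]
      show ?thesis
        using Y1_in_basis_iff[OF w_edge[OF s jk(1)] w_edge[OF s jk(2)]] r[OF s] jk top[OF s jk(2)]
        by (simp add: 2(3) Yc[OF s jk(2)])
    qed
  next
    fix c assume "c \<in> basis_cells"
    then consider x where "x \<in> E - T" "c = X1 x"
      | u a b where "{u, a} \<in> E" "{u, b} \<in> E" "r u a < r u b" "\<not> top_nb u b" "c = Y1 u a b"
      unfolding basis_cells_def by blast
    then show "c \<in> q ` I"
    proof cases
      case 1
      then obtain j where j: "j \<in> {1..n}" "x = e j" using e_im by blast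
      then have "Inl j \<in> I" "c = q (Inl j)" using 1 Xc by (auto simp: I_def IX_def q_def)
      then show ?thesis by blast
    next
      case 2
      obtain s where s: "s \<in> {1..m}" "u = v s" using edge_pair(3)[OF 2(1)] v_im by blast
      obtain j k where jk: "j \<in> {1..d s}" "k \<in> {1..d s}" "a = w s j" "b = w s k"
        using nb_obtain[OF s(1)] 2(1,2) unfolding s(2) by blast
      have "j < k" "k \<noteq> d s" using 2(3,4) r[OF s(1)] top[OF s(1) jk(2)] jk s(2) by auto
      then have "Inr (s, (j, k)) \<in> I" using s(1) jk(1,2) by (auto simp: I_def IS_def IY_def)
      moreover have "c = q (Inr (s, (j, k)))"
        using 2(5) Yc[OF s(1) jk(2)] jk s(2) by (simp add: q_def)
      ultimately show ?thesis by blast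
    qed
  qed
  have q_inj: "inj_on q I"
  proof (rule inj_onI)
    have X: "q (Inl j) = X1 (e j)" "e j \<in> E" "j \<in> {1..n}" if "Inl j \<in> I" for j
      using that Xc e_im by (auto simp: I_def IX_def q_def)
    have Y: "q (Inr (s, j, k)) = Y1 (v s) (w s j) (w s k)" "v s \<noteq> w s k"
        "s \<in> {1..m}" "j \<in> {1..d s}" "k \<in> {1..d s}" if "Inr (s, j, k) \<in> I" for s j k
    proof -
      have *: "s \<in> IS" "(j, k) \<in> IY s" using that by (auto simp: I_def)
      note s = IS[OF *(1)] and jk = IY[OF *(2)]
      show "q (Inr (s, j, k)) = Y1 (v s) (w s j) (w s k)" by (simp add: q_def Yc[OF s jk(2)])
      show "v s \<noteq> w s k" using edge_pair(1)[OF w_edge[OF s jk(2)]] .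
      show "s \<in> {1..m}" "j \<in> {1..d s}" "k \<in> {1..d s}" by fact+
    qed
    fix i i' assume i: "i \<in> I" "i' \<in> I" "q i = q i'"
    show "i = i'"
    proof (cases i)
      case (Inl j)
      note i1 = this
      show ?thesis
      proof (cases i')
        case (Inl j')
        then show ?thesis
          using i i1 X[of j] X[of j'] X1_eq_iff[of "e j" "e j'"] inj_onD[OF e_inj, of j j'] by simp
      next
        case (Inr p)
        obtain s k l where p: "p = (s, k, l)" by (cases p)
        show ?thesis
          using i i1 Inr p X(1,2)[of j] Y(1)[of s k l] X1_neq_Y1[of "e j" "v s" "w s k" "w s l"] by simp
      qed
    next
      case (Inr p)
      note i1 = this
      obtain s k l where p: "p = (s, k, l)" by (cases p)
      show ?thesis
      proof (cases i')
        case (Inl j)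
        then show ?thesis
          using i i1 p X(1,2)[of j] Y(1)[of s k l] X1_neq_Y1[of "e j" "v s" "w s k" "w s l"] by simp
      next
        case (Inr p')
        obtain s' k' l' where p': "p' = (s', k', l')" by (cases p')
        have I2: "Inr (s, k, l) \<in> I" "Inr (s', k', l') \<in> I" using i i1 p Inr p' by auto
        note Y1 = Y[OF I2(1)] and Y2 = Y[OF I2(2)]
        have "Y1 (v s) (w s k) (w s l) = Y1 (v s') (w s' k') (w s' l')"
          using i(3) Y1(1) Y2(1) i1 p Inr p' by simp
        then have *: "v s = v s'" "w s k = w s' k'" "w s l = w s' l'"
          using Y1_eq_iff[OF Y1(2) Y2(2)] by auto
        then have "s = s'" using inj_onD[OF v_inj] Y1(3) Y2(3) by blast
        moreover from this have "k = k'" "l = l'"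
          using * inj_onD[OF w_inj[OF Y1(3)]] Y1(4,5) Y2(4,5) by blast+
        ultimately show ?thesis using i1 p Inr p' by simp
      qed
    qed
  qed

  interpret H: comm_group H1 unfolding H1_def by (rule comm_group_H1)
  let ?b = "\<lambda>i. cls (dual_cochain V E 1 (q i))"
  have basis: "H.int_basis ?b I"
    unfolding H1_def using int_basis_cls[of q I] q_im q_inj by (simp add: bij_betw_def)
  have grp: "dual_class_group V E src tgt (q i) = subgroup_generated H1 {?b i}" for i
    by (simp add: dual_class_group_def H1_def)
  have cyc: "dual_class_group V E src tgt (q i) \<cong> integer_group" if "i \<in> I" for i
    unfolding grp by (rule H.int_basis_cyclic[OF basis that])
  have fin_IY: "finite (IY s)" for s
    by (rule finite_subset[of _ "{1..d s} \<times> {1..d s}"]) (auto simp: IY_def)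
  have fin: "finite IS" "finite IX" by (auto simp: IS_def IX_def)
  have iso: "(\<lambda>(x, y). finprod H1 x IX \<otimes>\<^bsub>H1\<^esub> finprod H1 (\<lambda>s. finprod H1 (y s) (IY s)) IS)
            \<in> iso (sum_group IX (\<lambda>j. dual_class_group V E src tgt (Xc j))
                   \<times>\<times> sum_group IS (\<lambda>s. sum_group (IY s)
                         (\<lambda>p. dual_class_group V E src tgt (Yc s p))))
                  H1"
    using H.int_basis_direct_sum[OF fin(1) fin_IY fin(2) basis[unfolded I_def]]
    unfolding grp[symmetric] by (simp add: q_def)

  have "card I = card IX + (\<Sum>s\<in>IS. card (IY s))"
    unfolding I_def using fin fin_IY by (simp add: card_Plus)
  moreover have "card IX + m = Suc n"
  proof -
    have "e ` IX = E - T" using e_im by (auto simp: IX_def)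
    moreover have "inj_on e IX" by (rule inj_on_subset[OF e_inj]) (auto simp: IX_def)
    ultimately have "card IX = card (E - T)" by (metis card_image)
    moreover have "card V = Suc (card T)"
    proof (rule spanning_tree_card)
      show "x = {src x, tgt x} \<and> src x \<noteq> tgt x \<and> src x \<in> V \<and> tgt x \<in> V" if "x \<in> T" for x
        using edge_ends[of x] T_sub that by blast
    qed (use finite_V finite_subset[OF T_sub finite_E] T in \<open>auto simp: spanning_tree_def\<close>)
    moreover have "card V = m" "card E = n"
      using bij_betw_same_card[OF v] bij_betw_same_card[OF e] by auto
    ultimately show ?thesis
      using card_Diff_subset[OF finite_subset[OF T_sub finite_E] T_sub] card_mono[OF finite_E T_sub] by simp
  qed
  moreover have "real (\<Sum>s\<in>IS. card (IY s)) = (\<Sum>s=1..m. ((real (d s))\<^sup>2 - 3 * real (d s) + 2) / 2)"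
  proof -
    have c: "real (card (IY s)) = ((real (d s))\<^sup>2 - 3 * real (d s) + 2) / 2" if "s \<in> {1..m}" for s
    proof -
      have "E \<noteq> {}" using e_im n by auto
      then have "d s \<ge> 1" unfolding d_def using vdeg_pos[OF conn fsg] v_im that by blast
      then obtain D where D: "d s = Suc D" by (cases "d s") auto
      have "2 * card (IY s) = D * (D - 1)"
        using card_ordered_pairs[of D] by (simp add: IY_def D)
      then have "2 * real (card (IY s)) = real (D * (D - 1))"
        by (metis of_nat_mult of_nat_numeral)
      also have "\<dots> = real D * (real D - 1)" by (cases D) (simp_all add: algebra_simps)
      finally have "2 * real (card (IY s)) = real D * (real D - 1)" .
      then show ?thesis by (simp add: D power2_eq_square algebra_simps)
    qed
    have "IY s = {}" if "s \<in> {1..m} - IS" for s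
      using that by (auto simp: IS_def IY_def)
    then have "(\<Sum>s\<in>IS. card (IY s)) = (\<Sum>s=1..m. card (IY s))"
      by (intro sum.mono_neutral_left) (auto simp: IS_def)
    then have "real (\<Sum>s\<in>IS. card (IY s)) = (\<Sum>s=1..m. real (card (IY s)))" by simp
    also have "\<dots> = (\<Sum>s=1..m. ((real (d s))\<^sup>2 - 3 * real (d s) + 2) / 2)"
      by (rule sum.cong[OF refl c])
    finally show ?thesis .
  qed
  moreover have "(\<Sum>s=1..m. real (d s)) = 2 * real n"
  proof -
    have "(\<Sum>s=1..m. d s) = (\<Sum>u\<in>V. vdeg E u)"
      unfolding d_def by (rule sum.reindex_bij_betw[OF v])
    also have "\<dots> = 2 * n" using sum_vdeg[OF fsg] bij_betw_same_card[OF e] by simp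
    finally show ?thesis by (metis of_nat_mult of_nat_numeral of_nat_sum)
  qed
  moreover have "(\<Sum>s=1..m. ((real (d s))\<^sup>2 - 3 * real (d s) + 2) / 2)
      = 1 / 2 * (\<Sum>s=1..m. (real (d s))\<^sup>2) - 3 / 2 * (\<Sum>s=1..m. real (d s)) + real m"
    by (simp add: sum.distrib sum_subtractf add_divide_distrib diff_divide_distrib
        sum_divide_distrib sum_distrib_left)
  ultimately have "real (card I) = 1 - 2 * real n + 1 / 2 * (\<Sum>s=1..m. (real (d s))\<^sup>2)"
    by simp
  then have rank: "ereal_of_enat (abelian_rank H1)
             = ereal (1 - 2 * real n + 1 / 2 * (\<Sum>s = 1..m. (real (d s))\<^sup>2))"
    unfolding H.int_basis_rank[OF basis] by simp
  have "\<forall>j\<in>IX. dual_class_group V E src tgt (Xc j) \<cong> integer_group"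
    using cyc[of "Inl _"] by (auto simp: I_def q_def)
  moreover have "\<forall>s\<in>IS. \<forall>p\<in>IY s. dual_class_group V E src tgt (Yc s p) \<cong> integer_group"
    using cyc[of "Inr (_, _)"] by (auto simp: I_def q_def)
  ultimately show ?thesis using iso rank by blast
qed

end
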